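(* Let $\alpha>-1$. Then $\{T_t^{\alpha,\Psi}\}_{t\ge0}$ is a Markovian symmetric diffusion semigroup on $(\mathbb{R}_+,\mu_\alpha)$.
   Context: Notation: $\mathbb{R}_+=(0,\infty)$, $d\mu_\alpha(x)=x^{2\alpha+1}dx$ on $\mathbb{R}_+$, $L^p=L^p(\mathbb{R}_+,\mu_\alpha)$, $\mathbf 1$ is the constant function $1$; $J_\nu$ and $I_\nu$ are, respectively, the Bessel function and the modified Bessel function of the first kind of order $\nu$. The semigroup. Let $\Psi_\lambda^\alpha(x)=(x\lambda)^{-\alpha}J_\alpha(x\lambda)$, $x,\lambda>0$; these are eigenfunctions, with eigenvalues $\lambda^2$, of the Bessel operator $L_\alpha^\Psi=-\frac{d^2}{dx^2}-\frac{2\alpha+1}{x}\frac{d}{dx}$. The modified Hankel transform $h_\alpha f(\lambda)=\int_0^\infty\Psi_\lambda^\alpha(x)f(x)\,d\mu_\alpha(x)$ extends to an isometry of $L^2(\mathbb{R}_+,\mu_\alpha)$ with $h_\alpha\circ h_\alpha=\mathrm{Id}$, and $L_\alpha^\Psi$ also denotes the self-adjoint extension whose spectral decomposition is given via $h_\alpha$. The Bessel semigroup is $T_t^{\alpha,\Psi}f=\exp(-tL_\alpha^\Psi)f=h_\alpha\big(e^{-t(\cdot)^2}h_\alpha f\big)$, $f\in L^2(\mathbb{R}_+,\mu_\alpha)$. For $t>0$ it has the integral representation $$T_t^{\alpha,\Psi}f(x)=\int_0^\infty G_t^{\alpha,\Psi}(x,y)f(y)\,d\mu_\alpha(y),\qquad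 G_t^{\alpha,\Psi}(x,y)=\frac1{2t}(xy)^{-\alpha}\exp\Big(-\frac{x^2+y^2}{4t}\Big)I_\alpha\Big(\frac{xy}{2t}\Big),$$ which defines $T_t^{\alpha,\Psi}$ on $L^1+L^\infty$; $T_0^{\alpha,\Psi}=\mathrm{Id}$. Definitions. On a $\sigma$-finite measure space $(X,\mu)$, a symmetric diffusion semigroup is a family of linear operators $\{T_t\}_{t\ge0}$, $T_0=\mathrm{Id}$, mapping a linear subspace of the measurable functions that contains all $L^p(X,\mu)$, $1\le p\le\infty$ (e.g. $L^1+L^\infty$) into measurable functions, such that: (i) for each $1\le p\le\infty$ every $T_t$ is a contraction on $L^p$ and $\{T_t\}_{t\ge0}$ is a semigroup there; (ii) each $T_t$ is self-adjoint on $L^2$; (iii) $\lim_{t\to0^+}T_tf=f$ in $L^2$ for each $f\in L^2$. It is Markovian if in addition (iv) $T_tf\ge0$ whenever $f\ge0$, for all $t$, and (v) $T_t\mathbf 1=\mathbf 1$ for all $t$. *)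

theory Defs
  imports "HOL-Analysis.Analysis" "HOL-Probability.Essential_Supremum"
begin

section \<open>Lebesgue spaces\<close>

text \<open>Functions are complex-valued representatives; identities between elements of Lebesgue
  spaces are stated almost everywhere. The exponent ranges over \<open>1 \<le> p \<le> \<infinity>\<close> in \<^typ>\<open>ennreal\<close>.\<close>

definition Lp_norm :: "'a measure \<Rightarrow> ennreal \<Rightarrow> ('a \<Rightarrow> complex) \<Rightarrow> ennreal" where
  "Lp_norm M p f =
     (if p = \<infinity> then esssup M (\<lambda>x. ennreal (cmod (f x)))
      else let I = (\<integral>\<^sup>+ x. ennreal (cmod (f x) powr enn2real p) \<partial>M)
           in if I = \<infinity> then \<infinity> else ennreal (enn2real I powr (1 / enn2real p)))"

definition Lp :: "'a measure \<Rightarrow> ennreal \<Rightarrow> ('a \<Rightarrow> complex) set" where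
  "Lp M p = {f \<in> borel_measurable M. Lp_norm M p f < \<infinity>}"

definition L1_plus_Linf :: "'a measure \<Rightarrow> ('a \<Rightarrow> complex) set" where
  "L1_plus_Linf M =
     {f \<in> borel_measurable M. \<exists>g\<in>Lp M 1. \<exists>h\<in>Lp M \<infinity>. AE x in M. f x = g x + h x}"


section \<open>Symmetric diffusion semigroups\<close>

text \<open>The parameter \<open>D\<close> is the common domain of the operators \<open>T t\<close>, \<open>t \<ge> 0\<close>. The
  assumptions \<open>domain_AE\<close> and \<open>well_defined\<close> say that \<open>D\<close> and \<open>T t\<close> make sense for functions
  modulo equality almost everywhere. Since each \<open>T t\<close> is everywhere defined and bounded on
  \<open>L\<^sup>2\<close> by \<open>contraction\<close>, being self-adjoint there is the identity in \<open>self_adjoint\<close>.\<close>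

locale symmetric_diffusion_semigroup = sigma_finite_measure M
  for M :: "'a measure"
    and D :: "('a \<Rightarrow> complex) set"
    and T :: "real \<Rightarrow> ('a \<Rightarrow> complex) \<Rightarrow> 'a \<Rightarrow> complex" +
  assumes domain_measurable: "D \<subseteq> borel_measurable M"
    and domain_subspace:
      "\<And>f g c d. f \<in> D \<Longrightarrow> g \<in> D \<Longrightarrow> (\<lambda>x. c * f x + d * g x) \<in> D"
    and domain_AE:
      "\<And>f g. f \<in> D \<Longrightarrow> g \<in> borel_measurable M \<Longrightarrow> (AE x in M. f x = g x) \<Longrightarrow> g \<in> D"
    and domain_Lp: "\<And>p. 1 \<le> p \<Longrightarrow> Lp M p \<subseteq> D"
    and range_measurable: "\<And>t f. 0 \<le> t \<Longrightarrow> f \<in> D \<Longrightarrow> T t f \<in> borel_measurable M"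
    and well_defined:
      "\<And>t f g. 0 \<le> t \<Longrightarrow> f \<in> D \<Longrightarrow> g \<in> D \<Longrightarrow> (AE x in M. f x = g x) \<Longrightarrow>
         (AE x in M. T t f x = T t g x)"
    and linear:
      "\<And>t f g c d. 0 \<le> t \<Longrightarrow> f \<in> D \<Longrightarrow> g \<in> D \<Longrightarrow>
         (AE x in M. T t (\<lambda>y. c * f y + d * g y) x = c * T t f x + d * T t g x)"
    and at_zero: "\<And>f. f \<in> D \<Longrightarrow> (AE x in M. T 0 f x = f x)"
    and contraction:
      "\<And>t p f. 0 \<le> t \<Longrightarrow> 1 \<le> p \<Longrightarrow> f \<in> Lp M p \<Longrightarrow>
         T t f \<in> Lp M p \<and> Lp_norm M p (T t f) \<le> Lp_norm M p f"
    and semigroup: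
      "\<And>s t p f. 0 \<le> s \<Longrightarrow> 0 \<le> t \<Longrightarrow> 1 \<le> p \<Longrightarrow> f \<in> Lp M p \<Longrightarrow>
         (AE x in M. T (s + t) f x = T s (T t f) x)"
    and self_adjoint:
      "\<And>t f g. 0 \<le> t \<Longrightarrow> f \<in> Lp M 2 \<Longrightarrow> g \<in> Lp M 2 \<Longrightarrow>
         (LINT x|M. T t f x * cnj (g x)) = (LINT x|M. f x * cnj (T t g x))"
    and strongly_continuous:
      "\<And>f. f \<in> Lp M 2 \<Longrightarrow>
         ((\<lambda>t. Lp_norm M 2 (\<lambda>x. T t f x - f x)) \<longlongrightarrow> 0) (at_right 0)"

locale markovian_symmetric_diffusion_semigroup = symmetric_diffusion_semigroup +
  assumes positive:
      "\<And>t f. 0 \<le> t \<Longrightarrow> f \<in> D \<Longrightarrow> (AE x in M. f x \<in> \<real>\<^sub>\<ge>\<^sub>0) \<Longrightarrow>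
         (AE x in M. T t f x \<in> \<real>\<^sub>\<ge>\<^sub>0)"
    and conservative: "\<And>t. 0 \<le> t \<Longrightarrow> (AE x in M. T t (\<lambda>_. 1) x = 1)"


section \<open>The Bessel semigroup\<close>

text \<open>Power series of the modified Bessel function \<open>I\<^sub>\<nu>\<close>, meant for \<open>x > 0\<close>.\<close>

definition bessel_I :: "real \<Rightarrow> real \<Rightarrow> real" where
  "bessel_I \<nu> x = (\<Sum>k. (x / 2) powr (2 * real k + \<nu>) * rGamma (\<nu> + real k + 1) / fact k)"

definition bessel_measure :: "real \<Rightarrow> real measure" where
  "bessel_measure \<alpha> =
     density (restrict_space lborel {0<..}) (\<lambda>x. ennreal (x powr (2 * \<alpha> + 1)))"

definition bessel_kernel :: "real \<Rightarrow> real \<Rightarrow> real \<Rightarrow> real \<Rightarrow> real" where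
  "bessel_kernel \<alpha> t x y =
     1 / (2 * t) * (x * y) powr (- \<alpha>) * exp (- (x\<^sup>2 + y\<^sup>2) / (4 * t)) * bessel_I \<alpha> (x * y / (2 * t))"

text \<open>The extension of the semigroup \<open>exp (- t L)\<close>, with \<open>L\<close> the Bessel operator, to
  \<open>L\<^sup>1 + L\<^sup>\<infinity>\<close> by its integral kernel. Only \<open>t \<ge> 0\<close> is meaningful.\<close>

definition bessel_semigroup :: "real \<Rightarrow> real \<Rightarrow> (real \<Rightarrow> complex) \<Rightarrow> real \<Rightarrow> complex" where
  "bessel_semigroup \<alpha> t f x =
     (if t = 0 then f x
      else LINT y|bessel_measure \<alpha>. complex_of_real (bessel_kernel \<alpha> t x y) * f y)"

end

theory Submission
  imports Defs
begin

text \<open>For \<open>t > 0\<close> the operator has a symmetric kernel. In the power series of the kernel each term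
  integrates to a Gamma value, so the kernel is a Poisson mixture of Gamma densities in
  \<open>y\<^sup>2 / (4 t)\<close>. Hence it has mass 1 and second moment
  \<open>\<integral> G\<^sub>t(x, y) (y\<^sup>2 - x\<^sup>2)\<^sup>2 d\<mu>(y) = 8 t x\<^sup>2 + 16 t\<^sup>2 (\<alpha> + 1) (\<alpha> + 2)\<close>, and the semigroup property is
  a coefficientwise Vandermonde convolution. Contractivity on every \<open>L\<^sup>p\<close> is Jensen's inequality
  together with symmetry. Jensen also bounds \<open>\<parallel>T\<^sub>t f - f\<parallel>\<^sup>2\<close> by the energy
  \<open>\<integral>\<integral> G\<^sub>t(x, y) |f x - f y|\<^sup>2\<close>, which tends to 0 for functions Lipschitz in \<open>x\<^sup>2\<close> with bounded
  support by the second moment, then for indicators by a Dynkin argument, and so for all of \<open>L\<^sup>2\<close>.\<close>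

section \<open>Lebesgue spaces\<close>

text \<open>The Hankel transform is bypassed: every axiom is read off from the kernel, and its power
  series has no fractional power of y left once the factor (xy)^(-\<alpha>) is absorbed, so all
  \<alpha> > -1 are treated alike and no asymptotics of the Bessel function enter. Distance is
  measured by y^2 - x^2 because even powers of y only shift the Gamma values by integers, which the
  Gamma recurrence resolves; odd powers would leave Gamma quotients at half-integer shifts that do
  not cancel against the series coefficients. The energy controls strong continuity well because it
  is quadratic and at most 4 times the squared norm, uniformly in t. Functions whose energy vanishes
  as t tends to 0 are thus closed under sums, multiples and \<open>L\<^sup>2\<close> limits, and a
  generating family is enough. All but the kernel computations is carried out for abstract symmetric
  Markov kernels, where one question stays open: whether the energy vanishes for indicators of sets
  of finite measure.\<close>

lemma Lp_ennreal_iff: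
  assumes "1 \<le> r"
  shows "f \<in> Lp M (ennreal r) \<longleftrightarrow>
    f \<in> borel_measurable M \<and> (\<integral>\<^sup>+x. ennreal (cmod (f x) powr r) \<partial>M) < \<infinity>"
  using assms by (auto simp: Lp_def Lp_norm_def Let_def less_top[symmetric])

lemma Lp_1_iff:
  "f \<in> Lp M 1 \<longleftrightarrow> f \<in> borel_measurable M \<and> (\<integral>\<^sup>+x. ennreal (cmod (f x)) \<partial>M) < \<infinity>"
  using Lp_ennreal_iff[of 1 f M] by simp

lemma Lp_2_iff:
  "f \<in> Lp M 2 \<longleftrightarrow> f \<in> borel_measurable M \<and> (\<integral>\<^sup>+x. ennreal ((cmod (f x))\<^sup>2) \<partial>M) < \<infinity>"
  using Lp_ennreal_iff[of 2 f M] by simp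

lemma Lp_infinity_iff:
  "f \<in> Lp M \<infinity> \<longleftrightarrow> f \<in> borel_measurable M \<and> (\<exists>C. AE x in M. cmod (f x) \<le> C)" (is "?L \<longleftrightarrow> ?R")
proof
  assume ?L
  then have f[measurable]: "f \<in> borel_measurable M"
    and fin: "esssup M (\<lambda>x. ennreal (cmod (f x))) < top"
    by (auto simp: Lp_def Lp_norm_def)
  define C where "C = enn2real (esssup M (\<lambda>x. ennreal (cmod (f x))))"
  have C: "esssup M (\<lambda>x. ennreal (cmod (f x))) = ennreal C" "0 \<le> C"
    using fin by (auto simp: C_def)
  have "AE x in M. ennreal (cmod (f x)) \<le> ennreal C"
    using esssup_AE[of "\<lambda>x. ennreal (cmod (f x))" M] C by simp
  then have "AE x in M. cmod (f x) \<le> C"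
    using C by (auto simp: ennreal_le_iff)
  then show ?R by auto
next
  assume ?R
  then obtain C where f[measurable]: "f \<in> borel_measurable M" and "AE x in M. cmod (f x) \<le> C"
    by auto
  then have "AE x in M. ennreal (cmod (f x)) \<le> ennreal C"
    by (auto intro: ennreal_leI)
  then have "esssup M (\<lambda>x. ennreal (cmod (f x))) \<le> ennreal C"
    by (intro esssup_I) auto
  then show ?L
    using f by (auto simp: Lp_def Lp_norm_def intro: order_le_less_trans)
qed

lemma Lp_norm_mono:
  assumes "1 \<le> r"
    and "(\<integral>\<^sup>+x. ennreal (cmod (f x) powr r) \<partial>M) \<le> (\<integral>\<^sup>+x. ennreal (cmod (g x) powr r) \<partial>M)"
  shows "Lp_norm M (ennreal r) f \<le> Lp_norm M (ennreal r) g"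
  using assms by (auto simp: Lp_norm_def Let_def less_top top_unique
      intro!: ennreal_leI powr_mono2 enn2real_mono)

lemma ennreal_exponent_cases:
  fixes p :: ennreal
  assumes "1 \<le> p"
  obtains (infinity) "p = \<infinity>" | (finite) r where "1 \<le> r" "p = ennreal r"
  using assms by (cases p) (auto simp: ennreal_1[symmetric] simp del: ennreal_1)

text \<open>Truncation at height 1: where |f| > 1 one has |f| \<le> |f|^r, so the large part is
  integrable, and the remaining part is bounded by 1.\<close>

lemma Lp_subset_L1_plus_Linf:
  assumes "1 \<le> p"
  shows "Lp M p \<subseteq> L1_plus_Linf M"
proof
  fix f assume f: "f \<in> Lp M p"
  then have [measurable]: "f \<in> borel_measurable M" by (simp add: Lp_def)
  have zero: "(\<lambda>_. 0) \<in> Lp M 1" by (simp add: Lp_1_iff)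
  from assms show "f \<in> L1_plus_Linf M"
  proof (cases p rule: ennreal_exponent_cases)
    case infinity
    with f zero show ?thesis unfolding L1_plus_Linf_def
      by (intro CollectI conjI bexI[of _ "\<lambda>_. 0"] bexI[of _ f]) auto
  next
    case (finite r)
    define g where "g x = (if 1 < cmod (f x) then f x else 0)" for x
    define h where "h x = (if 1 < cmod (f x) then 0 else f x)" for x
    have [measurable]: "g \<in> borel_measurable M" "h \<in> borel_measurable M"
      unfolding g_def[abs_def] h_def[abs_def] by measurable
    have "(\<integral>\<^sup>+x. ennreal (cmod (g x)) \<partial>M) \<le> (\<integral>\<^sup>+x. ennreal (cmod (f x) powr r) \<partial>M)"
      using powr_mono[of 1 r] finite(1)
      by (intro nn_integral_mono) (auto simp: g_def intro!: ennreal_leI)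
    also have "\<dots> < \<infinity>" using f finite by (simp add: Lp_ennreal_iff)
    finally have "g \<in> Lp M 1" by (simp add: Lp_1_iff)
    moreover have "h \<in> Lp M \<infinity>"
      unfolding Lp_infinity_iff by (auto simp: h_def intro!: exI[of _ 1])
    ultimately show ?thesis unfolding L1_plus_Linf_def
      by (intro CollectI conjI bexI[of _ g] bexI[of _ h]) (auto simp: g_def h_def)
  qed
qed

lemma L1_plus_Linf_measurable: "L1_plus_Linf M \<subseteq> borel_measurable M"
  by (auto simp: L1_plus_Linf_def)

lemma L1_plus_Linf_cong_AE:
  assumes "f \<in> L1_plus_Linf M" "g \<in> borel_measurable M" "AE x in M. f x = g x"
  shows "g \<in> L1_plus_Linf M"
proof -
  from assms(1) obtain u v where "u \<in> Lp M 1" "v \<in> Lp M \<infinity>" "AE x in M. f x = u x + v x"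
    by (auto simp: L1_plus_Linf_def)
  moreover from this(3) assms(3) have "AE x in M. g x = u x + v x" by eventually_elim simp
  ultimately show ?thesis using assms(2) by (auto simp: L1_plus_Linf_def)
qed

lemma Lp_1_linear:
  assumes "f \<in> Lp M 1" "g \<in> Lp M 1"
  shows "(\<lambda>x. c * f x + d * g x) \<in> Lp M 1"
proof -
  have [measurable]: "f \<in> borel_measurable M" "g \<in> borel_measurable M"
    using assms by (auto simp: Lp_1_iff)
  have "(\<integral>\<^sup>+x. ennreal (cmod (c * f x + d * g x)) \<partial>M)
      \<le> (\<integral>\<^sup>+x. ennreal (cmod c) * ennreal (cmod (f x)) + ennreal (cmod d) * ennreal (cmod (g x)) \<partial>M)"
    by (intro nn_integral_mono)
      (auto simp: ennreal_mult'[symmetric] ennreal_plus[symmetric] norm_mult[symmetric]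
        simp del: ennreal_plus intro!: ennreal_leI norm_triangle_ineq)
  also have "\<dots> = cmod c * (\<integral>\<^sup>+x. cmod (f x) \<partial>M) + cmod d * (\<integral>\<^sup>+x. cmod (g x) \<partial>M)"
    by (simp add: nn_integral_add nn_integral_cmult)
  also have "\<dots> < \<infinity>"
    using assms by (auto simp: Lp_1_iff ennreal_mult_less_top)
  finally show ?thesis by (simp add: Lp_1_iff)
qed

lemma Lp_infinity_linear:
  assumes "f \<in> Lp M \<infinity>" "g \<in> Lp M \<infinity>"
  shows "(\<lambda>x. c * f x + d * g x) \<in> Lp M \<infinity>"
proof -
  obtain A B where [measurable]: "f \<in> borel_measurable M" "g \<in> borel_measurable M"
    and A: "AE x in M. cmod (f x) \<le> A" and B: "AE x in M. cmod (g x) \<le> B"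
    using assms unfolding Lp_infinity_iff by auto
  from A B have "AE x in M. cmod (c * f x + d * g x) \<le> cmod c * A + cmod d * B"
  proof eventually_elim
    case (elim x)
    have "cmod (c * f x + d * g x) \<le> cmod c * cmod (f x) + cmod d * cmod (g x)"
      by (metis norm_mult norm_triangle_ineq)
    also have "\<dots> \<le> cmod c * A + cmod d * B"
      using elim by (intro add_mono mult_left_mono) auto
    finally show ?case .
  qed
  then show ?thesis unfolding Lp_infinity_iff by auto
qed

lemma L1_plus_Linf_linear:
  assumes "f \<in> L1_plus_Linf M" "g \<in> L1_plus_Linf M"
  shows "(\<lambda>x. c * f x + d * g x) \<in> L1_plus_Linf M"
proof -
  obtain f1 f2 g1 g2 where f: "f1 \<in> Lp M 1" "f2 \<in> Lp M \<infinity>" "AE x in M. f x = f1 x + f2 x"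
    and g: "g1 \<in> Lp M 1" "g2 \<in> Lp M \<infinity>" "AE x in M. g x = g1 x + g2 x"
    using assms by (auto simp: L1_plus_Linf_def)
  have [measurable]: "f \<in> borel_measurable M" "g \<in> borel_measurable M"
    using assms L1_plus_Linf_measurable by auto
  have "AE x in M. c * f x + d * g x = (c * f1 x + d * g1 x) + (c * f2 x + d * g2 x)"
    using f(3) g(3) by eventually_elim (simp add: algebra_simps)
  moreover have "(\<lambda>x. c * f x + d * g x) \<in> borel_measurable M" by measurable
  ultimately show ?thesis unfolding L1_plus_Linf_def
    by (intro CollectI conjI bexI[OF _ Lp_1_linear[OF f(1) g(1)]]
        bexI[OF _ Lp_infinity_linear[OF f(2) g(2)]])
qed

text \<open>An integral tending to 0 is eventually finite. From then on the infinite branch of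
  \<open>Lp_norm\<close> is excluded, and the norm is a square root, which is continuous at
  0.\<close>

lemma tendsto_Lp_norm_2_zero:
  assumes "((\<lambda>t. \<integral>\<^sup>+x. ennreal ((cmod (F t x))\<^sup>2) \<partial>M) \<longlongrightarrow> 0) H"
  shows "((\<lambda>t. Lp_norm M 2 (F t)) \<longlongrightarrow> 0) H"
proof -
  let ?I = "\<lambda>t. \<integral>\<^sup>+x. ennreal ((cmod (F t x))\<^sup>2) \<partial>M"
  have "\<forall>\<^sub>F t in H. ?I t < top"
    using order_tendstoD(2)[OF assms, of top] by simp
  then have "\<forall>\<^sub>F t in H. Lp_norm M 2 (F t) = ennreal (sqrt (enn2real (?I t)))"
    by eventually_elim (auto simp: Lp_norm_def Let_def powr_half_sqrt)
  moreover have "((\<lambda>t. ennreal (sqrt (enn2real (?I t)))) \<longlongrightarrow> ennreal (sqrt (enn2real 0))) H"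
    using assms by (intro tendsto_intros) auto
  ultimately show ?thesis
    by (simp add: tendsto_cong)
qed

text \<open>The graph of the convex function u^r lies above its tangent at c. The inequality is
  arranged so that no term is negative, which allows it to be integrated in \<open>ennreal\<close>.
  It is Young's inequality for u and c^(r-1) with the conjugate exponents r and r / (r - 1).\<close>

lemma powr_tangent_bound:
  fixes u c r :: real
  assumes "0 < c" "0 \<le> u" "1 \<le> r"
  shows "r * c powr (r - 1) * u \<le> u powr r + (r - 1) * c powr r"
proof (cases "r = 1")
  case False
  define q where "q = r / (r - 1)"
  have r: "1 < r" using False assms by simp
  have "u * c powr (r - 1) \<le> u powr r / r + (c powr (r - 1)) powr q / q"
    using r assms by (intro Youngs_inequality) (auto simp: q_def field_simps)
  also have "(c powr (r - 1)) powr q = c powr r"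
    using r by (simp add: powr_powr q_def)
  finally show ?thesis using r by (simp add: q_def field_simps)
qed (use assms in auto)

section \<open>Symmetric Markov kernels\<close>

text \<open>Mass 1 is stated as an \<open>ennreal\<close> integral, so it includes the integrability
  of \<open>k x\<close>. The conditions are limited to points of the space because the Bessel kernel
  is meant for positive arguments.\<close>

locale symmetric_markov_kernel = sigma_finite_measure M
  for M :: "'a measure" and k :: "'a \<Rightarrow> 'a \<Rightarrow> real" +
  assumes kernel_measurable_pair: "(\<lambda>p. k (fst p) (snd p)) \<in> borel_measurable (M \<Otimes>\<^sub>M M)"
    and kernel_nonneg: "x \<in> space M \<Longrightarrow> y \<in> space M \<Longrightarrow> 0 \<le> k x y"
    and kernel_symmetric: "x \<in> space M \<Longrightarrow> y \<in> space M \<Longrightarrow> k x y = k y x"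
    and kernel_stochastic: "x \<in> space M \<Longrightarrow> (\<integral>\<^sup>+y. ennreal (k x y) \<partial>M) = 1"
begin

sublocale pair: pair_sigma_finite M M ..

text \<open>Recasts joint measurability as a composition rule, the form in which the measurability
  prover can use it below.\<close>

lemma kernel_measurable[measurable (raw)]:
  assumes "f \<in> N \<rightarrow>\<^sub>M M" "g \<in> N \<rightarrow>\<^sub>M M"
  shows "(\<lambda>z. k (f z) (g z)) \<in> borel_measurable N"
proof -
  have "(\<lambda>z. (f z, g z)) \<in> N \<rightarrow>\<^sub>M M \<Otimes>\<^sub>M M" using assms by measurable
  from measurable_compose[OF this kernel_measurable_pair] show ?thesis by simp
qed

text \<open>Where the integrand is not integrable the value is the default 0. For \<open>f\<close>
  in \<open>L1_plus_Linf\<close> this happens only on a null set, by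
  \<open>AE_kernel_integrable\<close>.\<close>

definition kernel_op :: "('a \<Rightarrow> complex) \<Rightarrow> 'a \<Rightarrow> complex" where
  "kernel_op f x = (LINT y|M. complex_of_real (k x y) * f y)"

text \<open>For square integrable f and the operator T of the kernel, expanding the square gives 2
  <f - T f, f>: up to a constant, the Dirichlet form of T.\<close>

definition kernel_energy :: "('a \<Rightarrow> real) \<Rightarrow> ennreal" where
  "kernel_energy f = (\<integral>\<^sup>+x. \<integral>\<^sup>+y. ennreal (k x y) * ennreal ((f x - f y)\<^sup>2) \<partial>M \<partial>M)"

lemma kernel_op_measurable[measurable]:
  assumes [measurable]: "f \<in> borel_measurable M"
  shows "kernel_op f \<in> borel_measurable M"
  unfolding kernel_op_def[abs_def] by measurable

text \<open>By symmetry the kernel has mass 1 in its first variable too, so \<open>M\<close> is an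
  invariant measure. Tonelli's theorem then integrates the kernel away.\<close>

lemma nn_integral_kernel:
  assumes [measurable]: "u \<in> borel_measurable M"
  shows "(\<integral>\<^sup>+x. \<integral>\<^sup>+y. ennreal (k x y) * u y \<partial>M \<partial>M) = (\<integral>\<^sup>+y. u y \<partial>M)"
proof -
  have "(\<integral>\<^sup>+x. \<integral>\<^sup>+y. ennreal (k x y) * u y \<partial>M \<partial>M) = (\<integral>\<^sup>+y. \<integral>\<^sup>+x. ennreal (k x y) * u y \<partial>M \<partial>M)"
    by (rule pair.Fubini'[symmetric]) measurable
  also have "\<dots> = (\<integral>\<^sup>+y. \<integral>\<^sup>+x. ennreal (k y x) * u y \<partial>M \<partial>M)"
    by (intro nn_integral_cong) (simp add: kernel_symmetric)
  also have "\<dots> = (\<integral>\<^sup>+y. u y \<partial>M)"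
    by (intro nn_integral_cong) (simp add: nn_integral_multc kernel_stochastic)
  finally show ?thesis .
qed

lemma nn_integral_kernel_const:
  assumes "x \<in> space M"
  shows "(\<integral>\<^sup>+y. ennreal (k x y) * c \<partial>M) = c"
  using assms by (simp add: nn_integral_multc kernel_stochastic)

text \<open>For the \<open>L\<^sup>1\<close> part the double integral is finite by invariance of the
  measure, so the inner one is finite almost everywhere. The bounded part contributes at most its
  bound at every point, by mass 1.\<close>

lemma AE_kernel_finite:
  assumes f: "f \<in> L1_plus_Linf M"
  shows "AE x in M. (\<integral>\<^sup>+y. ennreal (k x y) * ennreal (cmod (f y)) \<partial>M) < \<infinity>"
proof -
  obtain g h where g: "g \<in> Lp M 1" and h: "h \<in> Lp M \<infinity>" and fgh: "AE x in M. f x = g x + h x"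
    and [measurable]: "f \<in> borel_measurable M"
    using f by (auto simp: L1_plus_Linf_def)
  have [measurable]: "g \<in> borel_measurable M" "h \<in> borel_measurable M"
    using g h by (auto simp: Lp_def)
  obtain C where C: "AE x in M. cmod (h x) \<le> C"
    using h unfolding Lp_infinity_iff by auto
  have "(\<integral>\<^sup>+x. \<integral>\<^sup>+y. ennreal (k x y) * ennreal (cmod (g y)) \<partial>M \<partial>M) \<noteq> \<infinity>"
    using g by (simp add: nn_integral_kernel Lp_1_iff less_top)
  then have "AE x in M. (\<integral>\<^sup>+y. ennreal (k x y) * ennreal (cmod (g y)) \<partial>M) \<noteq> \<infinity>"
    by (intro nn_integral_PInf_AE) auto
  then show ?thesis
  proof (rule AE_mp, intro AE_I2 impI)
    fix x assume x: "x \<in> space M" and fin: "(\<integral>\<^sup>+y. ennreal (k x y) * ennreal (cmod (g y)) \<partial>M) \<noteq> \<infinity>"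
    have "(\<integral>\<^sup>+y. ennreal (k x y) * ennreal (cmod (f y)) \<partial>M)
      \<le> (\<integral>\<^sup>+y. ennreal (k x y) * ennreal (cmod (g y)) + ennreal (k x y) * ennreal C \<partial>M)"
    proof (rule nn_integral_mono_AE)
      show "AE y in M. ennreal (k x y) * ennreal (cmod (f y))
          \<le> ennreal (k x y) * ennreal (cmod (g y)) + ennreal (k x y) * ennreal C"
        using fgh C
      proof eventually_elim
        case (elim y)
        have "cmod (f y) \<le> cmod (g y) + C"
          using elim norm_triangle_ineq[of "g y" "h y"] by simp
        then have "ennreal (cmod (f y)) \<le> ennreal (cmod (g y)) + ennreal C"
          using elim by (metis ennreal_leI ennreal_plus norm_ge_zero order_trans)
        then show ?case by (metis distrib_left mult_left_mono zero_le)
      qed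
    qed
    also have "\<dots> = (\<integral>\<^sup>+y. ennreal (k x y) * ennreal (cmod (g y)) \<partial>M) + ennreal C"
      using x by (simp add: nn_integral_add nn_integral_kernel_const)
    also have "\<dots> < \<infinity>" using fin by (simp add: less_top)
    finally show "(\<integral>\<^sup>+y. ennreal (k x y) * ennreal (cmod (f y)) \<partial>M) < \<infinity>" .
  qed
qed

lemma integrable_kernel_iff:
  assumes "x \<in> space M" and [measurable]: "f \<in> borel_measurable M"
  shows "integrable M (\<lambda>y. complex_of_real (k x y) * f y) \<longleftrightarrow>
    (\<integral>\<^sup>+y. ennreal (k x y) * ennreal (cmod (f y)) \<partial>M) < \<infinity>"
proof -
  have "(\<integral>\<^sup>+y. ennreal (norm (complex_of_real (k x y) * f y)) \<partial>M)
      = (\<integral>\<^sup>+y. ennreal (k x y) * ennreal (cmod (f y)) \<partial>M)"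
    using assms(1) by (intro nn_integral_cong) (simp add: norm_mult kernel_nonneg ennreal_mult)
  moreover have "(\<lambda>y. complex_of_real (k x y) * f y) \<in> borel_measurable M"
    using assms(1) by measurable
  ultimately show ?thesis by (simp add: integrable_iff_bounded)
qed

lemma AE_kernel_integrable:
  assumes "f \<in> L1_plus_Linf M"
  shows "AE x in M. integrable M (\<lambda>y. complex_of_real (k x y) * f y)"
proof -
  have [measurable]: "f \<in> borel_measurable M" using assms L1_plus_Linf_measurable by auto
  show ?thesis using AE_kernel_finite[OF assms] AE_space
    by eventually_elim (simp add: integrable_kernel_iff)
qed

text \<open>Additivity is claimed almost everywhere since it may fail at points where one of the two
  integrals diverges and takes its default value.\<close>

lemma kernel_op_linear:
  assumes "f \<in> L1_plus_Linf M" "g \<in> L1_plus_Linf M"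
  shows "AE x in M. kernel_op (\<lambda>y. c * f y + d * g y) x = c * kernel_op f x + d * kernel_op g x"
  using AE_kernel_integrable[OF assms(1)] AE_kernel_integrable[OF assms(2)]
proof eventually_elim
  case (elim x)
  have "kernel_op (\<lambda>y. c * f y + d * g y) x
      = (LINT y|M. c * (complex_of_real (k x y) * f y) + d * (complex_of_real (k x y) * g y))"
    unfolding kernel_op_def by (intro Bochner_Integration.integral_cong) (auto simp: algebra_simps)
  also have "\<dots> = c * kernel_op f x + d * kernel_op g x"
    using elim by (simp add: kernel_op_def)
  finally show ?case .
qed

lemma kernel_op_cong_AE:
  assumes [measurable]: "f \<in> borel_measurable M" "g \<in> borel_measurable M"
    and "AE y in M. f y = g y" and "x \<in> space M"
  shows "kernel_op f x = kernel_op g x"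
  unfolding kernel_op_def using assms(3,4) by (intro integral_cong_AE) (measurable, auto)

lemma kernel_op_norm_bound:
  assumes "x \<in> space M" and [measurable]: "f \<in> borel_measurable M"
  shows "ennreal (cmod (kernel_op f x)) \<le> (\<integral>\<^sup>+y. ennreal (k x y) * ennreal (cmod (f y)) \<partial>M)"
proof (cases "integrable M (\<lambda>y. complex_of_real (k x y) * f y)")
  case True
  have "ennreal (cmod (kernel_op f x)) \<le> (\<integral>\<^sup>+y. ennreal (norm (complex_of_real (k x y) * f y)) \<partial>M)"
    unfolding kernel_op_def by (rule integral_norm_bound_ennreal[OF True])
  also have "\<dots> = (\<integral>\<^sup>+y. ennreal (k x y) * ennreal (cmod (f y)) \<partial>M)"
    using assms(1) by (intro nn_integral_cong) (simp add: norm_mult kernel_nonneg ennreal_mult)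
  finally show ?thesis .
\<comment> \<open>Without integrability the left side is the default value 0.\<close>
qed (simp add: kernel_op_def not_integrable_integral_eq)

text \<open>Integrate the tangent of \<open>u \<mapsto> u powr r\<close> at the modulus of the mean.\<close>

lemma kernel_op_jensen:
  assumes x: "x \<in> space M" and r: "1 \<le> r" and [measurable]: "f \<in> borel_measurable M"
  shows "ennreal (cmod (kernel_op f x) powr r)
    \<le> (\<integral>\<^sup>+y. ennreal (k x y) * ennreal (cmod (f y) powr r) \<partial>M)" (is "_ \<le> ?J")
proof (cases "kernel_op f x = 0")
  case False
  define c where "c = cmod (kernel_op f x)"
  have c: "0 < c" using False by (simp add: c_def)
  have [measurable]: "(\<lambda>y. k x y) \<in> borel_measurable M" using x by measurable
  \<comment> \<open>One factor c is split off because it is the modulus of the mean, to which the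
    norm bound applies; the rest is the slope of the tangent.\<close>
  have "ennreal (r * c powr r) = ennreal (r * c powr (r - 1)) * ennreal c"
    using c r by (simp add: ennreal_mult[symmetric] powr_mult_base mult.assoc mult.commute[of _ c])
  also have "\<dots> \<le> ennreal (r * c powr (r - 1)) * (\<integral>\<^sup>+y. ennreal (k x y) * ennreal (cmod (f y)) \<partial>M)"
    using kernel_op_norm_bound[OF x] by (intro mult_left_mono) (auto simp: c_def)
  also have "\<dots> = (\<integral>\<^sup>+y. ennreal (k x y) * ennreal (r * c powr (r - 1) * cmod (f y)) \<partial>M)"
    using r by (simp add: nn_integral_cmult[symmetric] ennreal_mult mult.left_commute)
  also have "\<dots> \<le> (\<integral>\<^sup>+y. ennreal (k x y) * (ennreal (cmod (f y) powr r) + ennreal ((r - 1) * c powr r)) \<partial>M)"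
  proof (intro nn_integral_mono mult_left_mono)
    fix y
    show "ennreal (r * c powr (r - 1) * cmod (f y))
        \<le> ennreal (cmod (f y) powr r) + ennreal ((r - 1) * c powr r)"
      using powr_tangent_bound[OF c norm_ge_zero r, of "f y"] r
      by (simp add: ennreal_plus[symmetric] ennreal_leI del: ennreal_plus)
  qed simp
  also have "\<dots> = ?J + ennreal ((r - 1) * c powr r)"
    using x by (simp add: distrib_left nn_integral_add nn_integral_kernel_const)
  also have "ennreal (r * c powr r) = ennreal ((r - 1) * c powr r) + ennreal (c powr r)"
    using r by (subst ennreal_plus[symmetric]) (auto simp: algebra_simps mult_le_cancel_right1)
  finally have "ennreal ((r - 1) * c powr r) + ennreal (c powr r) \<le> ennreal ((r - 1) * c powr r) + ?J"
    by (simp only: add.commute)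
  \<comment> \<open>The common summand is finite and therefore cancels in
    \<open>ennreal\<close>.\<close>
  then show ?thesis by (simp only: ennreal_add_left_cancel_le c_def) simp
qed simp

lemma kernel_op_contraction:
  assumes p: "1 \<le> p" and f: "f \<in> Lp M p"
  shows "kernel_op f \<in> Lp M p \<and> Lp_norm M p (kernel_op f) \<le> Lp_norm M p f"
proof -
  have [measurable]: "f \<in> borel_measurable M" using f by (simp add: Lp_def)
  have "Lp_norm M p (kernel_op f) \<le> Lp_norm M p f"
    using p
  proof (cases p rule: ennreal_exponent_cases)
    case infinity
    let ?C = "esssup M (\<lambda>x. ennreal (cmod (f x)))"
    \<comment> \<open>For the infinite exponent the bound is an average of the essential supremum
      against a kernel of mass 1, and it holds at every point.\<close>
    have "ennreal (cmod (kernel_op f x)) \<le> ?C" if x: "x \<in> space M" for x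
    proof -
      have "ennreal (cmod (kernel_op f x)) \<le> (\<integral>\<^sup>+y. ennreal (k x y) * ennreal (cmod (f y)) \<partial>M)"
        using x by (rule kernel_op_norm_bound) measurable
      also have "\<dots> \<le> (\<integral>\<^sup>+y. ennreal (k x y) * ?C \<partial>M)"
        by (intro nn_integral_mono_AE eventually_mono[OF esssup_AE[of "\<lambda>x. ennreal (cmod (f x))" M]])
          (simp add: mult_left_mono)
      finally show ?thesis using x by (simp add: nn_integral_kernel_const)
    qed
    then show ?thesis using infinity by (auto simp: Lp_norm_def intro!: esssup_I AE_I2)
  next
    case (finite r)
    have "(\<integral>\<^sup>+x. ennreal (cmod (kernel_op f x) powr r) \<partial>M)
        \<le> (\<integral>\<^sup>+x. \<integral>\<^sup>+y. ennreal (k x y) * ennreal (cmod (f y) powr r) \<partial>M \<partial>M)"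
      using finite by (intro nn_integral_mono kernel_op_jensen) auto
    also have "\<dots> = (\<integral>\<^sup>+x. ennreal (cmod (f x) powr r) \<partial>M)"
      by (rule nn_integral_kernel) measurable
    finally show ?thesis using finite by (simp add: Lp_norm_mono)
  qed
  then show ?thesis using f by (auto simp: Lp_def)
qed

text \<open>Fubini's theorem and symmetry of the kernel. The double integral converges absolutely
  because |f(y) g(x)| \<le> |f(y)|^2 + |g(x)|^2, and the kernel has mass 1 in either
  variable.\<close>

lemma kernel_op_self_adjoint:
  assumes "f \<in> Lp M 2" "g \<in> Lp M 2"
  shows "(LINT x|M. kernel_op f x * cnj (g x)) = (LINT x|M. f x * cnj (kernel_op g x))"
proof -
  have [measurable]: "f \<in> borel_measurable M" "g \<in> borel_measurable M"
    and fin: "(\<integral>\<^sup>+x. ennreal ((cmod (f x))\<^sup>2) \<partial>M) < \<infinity>" "(\<integral>\<^sup>+x. ennreal ((cmod (g x))\<^sup>2) \<partial>M) < \<infinity>"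
    using assms by (auto simp: Lp_2_iff)
  have [measurable]: "(\<lambda>x. cnj (g x)) \<in> borel_measurable M"
    by (rule measurable_compose[OF \<open>g \<in> borel_measurable M\<close>])
      (intro borel_measurable_continuous_onI continuous_intros)
  define F where "F = (\<lambda>(x, y). complex_of_real (k x y) * f y * cnj (g x))"
  have [measurable]: "F \<in> borel_measurable (M \<Otimes>\<^sub>M M)" unfolding F_def by measurable
  have "(\<integral>\<^sup>+z. ennreal (norm (F z)) \<partial>(M \<Otimes>\<^sub>M M)) = (\<integral>\<^sup>+x. \<integral>\<^sup>+y. ennreal (norm (F (x, y))) \<partial>M \<partial>M)"
    using nn_integral_fst[of "\<lambda>z. ennreal (norm (F z))" M] by simp
  also have "\<dots> \<le> (\<integral>\<^sup>+x. \<integral>\<^sup>+y. ennreal (k x y) * ennreal ((cmod (f y))\<^sup>2)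
      + ennreal (k x y) * ennreal ((cmod (g x))\<^sup>2) \<partial>M \<partial>M)"
  proof (intro nn_integral_mono)
    fix x y assume "x \<in> space M" "y \<in> space M"
    then have k: "0 \<le> k x y" by (rule kernel_nonneg)
    have "2 * (cmod (f y) * cmod (g x)) \<le> (cmod (f y))\<^sup>2 + (cmod (g x))\<^sup>2"
      using sum_squares_bound[of "cmod (f y)" "cmod (g x)"] by (simp add: mult.assoc)
    moreover have "0 \<le> cmod (f y) * cmod (g x)" by simp
    ultimately have "cmod (f y) * cmod (g x) \<le> (cmod (f y))\<^sup>2 + (cmod (g x))\<^sup>2" by linarith
    from mult_left_mono[OF this k]
    have "norm (F (x, y)) \<le> k x y * (cmod (f y))\<^sup>2 + k x y * (cmod (g x))\<^sup>2"
      using k by (simp add: F_def norm_mult algebra_simps)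
    then show "ennreal (norm (F (x, y))) \<le> ennreal (k x y) * ennreal ((cmod (f y))\<^sup>2)
      + ennreal (k x y) * ennreal ((cmod (g x))\<^sup>2)"
      using k by (simp add: ennreal_mult[symmetric] ennreal_plus[symmetric] ennreal_leI del: ennreal_plus)
  qed
  also have "\<dots> = (\<integral>\<^sup>+x. (\<integral>\<^sup>+y. ennreal (k x y) * ennreal ((cmod (f y))\<^sup>2) \<partial>M)
      + ennreal ((cmod (g x))\<^sup>2) \<partial>M)"
    by (intro nn_integral_cong) (simp add: nn_integral_add nn_integral_kernel_const)
  also have "\<dots> = (\<integral>\<^sup>+x. ennreal ((cmod (f x))\<^sup>2) \<partial>M) + (\<integral>\<^sup>+x. ennreal ((cmod (g x))\<^sup>2) \<partial>M)"
    by (simp add: nn_integral_add nn_integral_kernel)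
  also have "\<dots> < \<infinity>" using fin by simp
  finally have F: "integrable (M \<Otimes>\<^sub>M M) F" by (simp add: integrable_iff_bounded)
  then have "(LINT y|M. LINT x|M. F (x, y)) = (LINT x|M. LINT y|M. F (x, y))"
    using pair.Fubini_integral[of "\<lambda>x y. F (x, y)"] by simp
  moreover have "(LINT x|M. LINT y|M. F (x, y)) = (LINT x|M. kernel_op f x * cnj (g x))"
    by (simp add: F_def kernel_op_def)
  moreover have "(LINT y|M. LINT x|M. F (x, y)) = (LINT y|M. f y * cnj (kernel_op g y))"
  proof (intro Bochner_Integration.integral_cong refl)
    fix y assume y: "y \<in> space M"
    have "(LINT x|M. F (x, y)) = (LINT x|M. f y * cnj (complex_of_real (k y x) * g x))"
      using y by (intro Bochner_Integration.integral_cong refl) (simp add: F_def kernel_symmetric[of y])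
    also have "\<dots> = f y * (LINT x|M. cnj (complex_of_real (k y x) * g x))"
      by (rule integral_mult_right_zero)
    also have "\<dots> = f y * cnj (kernel_op g y)"
      by (simp only: kernel_op_def Bochner_Integration.integral_cnj)
    finally show "(LINT x|M. F (x, y)) = f y * cnj (kernel_op g y)" .
  qed
  ultimately show ?thesis by simp
qed

text \<open>The function is replaced by its real part, which agrees with it almost everywhere. The
  claim covers every point, since the default value 0 of a divergent integral is nonnegative as
  well.\<close>

lemma kernel_op_positive:
  assumes "f \<in> borel_measurable M" "AE x in M. f x \<in> \<real>\<^sub>\<ge>\<^sub>0" "x \<in> space M"
  shows "kernel_op f x \<in> \<real>\<^sub>\<ge>\<^sub>0"
proof -
  have "kernel_op f x = kernel_op (\<lambda>y. complex_of_real (Re (f y))) x"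
    using assms by (intro kernel_op_cong_AE) (auto elim!: AE_mp intro!: AE_I2 simp: complex_nonneg_Reals_iff complex_eq_iff)
  also have "\<dots> = complex_of_real (LINT y|M. k x y * Re (f y))"
    by (simp add: kernel_op_def flip: of_real_mult)
  moreover have "AE y in M. 0 \<le> k x y * Re (f y)"
    using assms(2) AE_space
    by eventually_elim (use assms(3) in \<open>auto simp: complex_nonneg_Reals_iff kernel_nonneg\<close>)
  ultimately show ?thesis
    by (simp add: integral_nonneg_AE)
qed

lemma kernel_op_one:
  assumes x: "x \<in> space M"
  shows "kernel_op (\<lambda>_. 1) x = 1"
proof -
  have [measurable]: "(\<lambda>y. k x y) \<in> borel_measurable M" using x by measurable
  have "has_bochner_integral M (\<lambda>y. k x y) 1"
    using x by (intro has_bochner_integral_nn_integral) (auto simp: kernel_nonneg kernel_stochastic)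
  then show ?thesis by (simp add: kernel_op_def has_bochner_integral_integral_eq)
qed

section \<open>Estimates for the energy of a kernel\<close>

lemma nn_integral_kernel_left:
  assumes [measurable]: "u \<in> borel_measurable M"
  shows "(\<integral>\<^sup>+x. \<integral>\<^sup>+y. ennreal (k x y) * u x \<partial>M \<partial>M) = (\<integral>\<^sup>+y. u y \<partial>M)"
  by (intro nn_integral_cong) (simp add: nn_integral_kernel_const)

lemma nn_integral_pair_add:
  assumes [measurable]: "case_prod F \<in> borel_measurable (M \<Otimes>\<^sub>M M)" "case_prod G \<in> borel_measurable (M \<Otimes>\<^sub>M M)"
  shows "(\<integral>\<^sup>+x. \<integral>\<^sup>+y. F x y + G x y \<partial>M \<partial>M) = (\<integral>\<^sup>+x. \<integral>\<^sup>+y. F x y \<partial>M \<partial>M) + (\<integral>\<^sup>+x. \<integral>\<^sup>+y. G x y \<partial>M \<partial>M)"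
proof -
  have "(\<integral>\<^sup>+x. \<integral>\<^sup>+y. F x y + G x y \<partial>M \<partial>M) = (\<integral>\<^sup>+x. (\<integral>\<^sup>+y. F x y \<partial>M) + (\<integral>\<^sup>+y. G x y \<partial>M) \<partial>M)"
    by (intro nn_integral_cong nn_integral_add) auto
  then show ?thesis by (simp add: nn_integral_add)
qed

lemma nn_integral_pair_cmult:
  assumes [measurable]: "case_prod F \<in> borel_measurable (M \<Otimes>\<^sub>M M)"
  shows "(\<integral>\<^sup>+x. \<integral>\<^sup>+y. c * F x y \<partial>M \<partial>M) = c * (\<integral>\<^sup>+x. \<integral>\<^sup>+y. F x y \<partial>M \<partial>M)"
proof -
  have "(\<integral>\<^sup>+x. \<integral>\<^sup>+y. c * F x y \<partial>M \<partial>M) = (\<integral>\<^sup>+x. c * (\<integral>\<^sup>+y. F x y \<partial>M) \<partial>M)"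
    by (intro nn_integral_cong nn_integral_cmult) auto
  then show ?thesis by (simp add: nn_integral_cmult)
qed

text \<open>Integrates (a + b)^2 \<le> 2 a^2 + 2 b^2 for the two increments.\<close>

lemma kernel_energy_add:
  assumes [measurable]: "f \<in> borel_measurable M" "g \<in> borel_measurable M"
  shows "kernel_energy (\<lambda>x. f x + g x) \<le> 2 * kernel_energy f + 2 * kernel_energy g"
proof -
  have "kernel_energy (\<lambda>x. f x + g x) \<le> (\<integral>\<^sup>+x. \<integral>\<^sup>+y. 2 * (ennreal (k x y) * ennreal ((f x - f y)\<^sup>2))
      + 2 * (ennreal (k x y) * ennreal ((g x - g y)\<^sup>2)) \<partial>M \<partial>M)"
    unfolding kernel_energy_def
  proof (intro nn_integral_mono)
    fix x y assume "x \<in> space M" "y \<in> space M"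
    then have k: "0 \<le> k x y" by (rule kernel_nonneg)
    have "0 \<le> ((f x - f y) - (g x - g y))\<^sup>2" by simp
    then have "(f x + g x - (f y + g y))\<^sup>2 \<le> 2 * (f x - f y)\<^sup>2 + 2 * (g x - g y)\<^sup>2"
      by (simp add: power2_eq_square algebra_simps)
    from mult_left_mono[OF this k]
    have "k x y * (f x + g x - (f y + g y))\<^sup>2 \<le> 2 * (k x y * (f x - f y)\<^sup>2) + 2 * (k x y * (g x - g y)\<^sup>2)"
      by (simp add: algebra_simps)
    from ennreal_leI[OF this]
    show "ennreal (k x y) * ennreal ((f x + g x - (f y + g y))\<^sup>2)
      \<le> 2 * (ennreal (k x y) * ennreal ((f x - f y)\<^sup>2)) + 2 * (ennreal (k x y) * ennreal ((g x - g y)\<^sup>2))"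
      using k by (simp add: ennreal_mult)
  qed
  also have "\<dots> = 2 * kernel_energy f + 2 * kernel_energy g"
    unfolding kernel_energy_def by (simp add: nn_integral_pair_add nn_integral_pair_cmult)
  finally show ?thesis .
qed

lemma kernel_energy_cmult:
  assumes [measurable]: "f \<in> borel_measurable M"
  shows "kernel_energy (\<lambda>x. c * f x) = ennreal (c\<^sup>2) * kernel_energy f"
  unfolding kernel_energy_def
  by (simp add: nn_integral_pair_cmult[symmetric] right_diff_distrib[symmetric] power_mult_distrib
      ennreal_mult mult.left_commute)

text \<open>Each of the two squares f(x)^2 and f(y)^2 enters with factor 2 and integrates to the
  squared norm, hence the constant 4. It does not depend on the kernel, so along a semigroup the
  bound is uniform in time.\<close>

lemma kernel_energy_le:
  assumes [measurable]: "f \<in> borel_measurable M"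
  shows "kernel_energy f \<le> 4 * (\<integral>\<^sup>+x. ennreal ((f x)\<^sup>2) \<partial>M)"
proof -
  have "kernel_energy f \<le> (\<integral>\<^sup>+x. \<integral>\<^sup>+y. 2 * (ennreal (k x y) * ennreal ((f x)\<^sup>2))
      + 2 * (ennreal (k x y) * ennreal ((f y)\<^sup>2)) \<partial>M \<partial>M)"
    unfolding kernel_energy_def
  proof (intro nn_integral_mono)
    fix x y assume "x \<in> space M" "y \<in> space M"
    then have k: "0 \<le> k x y" by (rule kernel_nonneg)
    have "0 \<le> (f x + f y)\<^sup>2" by simp
    then have "(f x - f y)\<^sup>2 \<le> 2 * (f x)\<^sup>2 + 2 * (f y)\<^sup>2"
      by (simp add: power2_eq_square algebra_simps)
    from mult_left_mono[OF this k]
    have "k x y * (f x - f y)\<^sup>2 \<le> 2 * (k x y * (f x)\<^sup>2) + 2 * (k x y * (f y)\<^sup>2)"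
      by (simp add: algebra_simps)
    from ennreal_leI[OF this]
    show "ennreal (k x y) * ennreal ((f x - f y)\<^sup>2)
      \<le> 2 * (ennreal (k x y) * ennreal ((f x)\<^sup>2)) + 2 * (ennreal (k x y) * ennreal ((f y)\<^sup>2))"
      using k by (simp add: ennreal_mult)
  qed
  also have "\<dots> = 2 * (\<integral>\<^sup>+x. ennreal ((f x)\<^sup>2) \<partial>M) + 2 * (\<integral>\<^sup>+x. ennreal ((f x)\<^sup>2) \<partial>M)"
    by (simp add: nn_integral_pair_add nn_integral_pair_cmult nn_integral_kernel nn_integral_kernel_left)
  also have "\<dots> = 4 * (\<integral>\<^sup>+x. ennreal ((f x)\<^sup>2) \<partial>M)"
    by (simp add: distrib_right[symmetric])
  finally show ?thesis .
qed

text \<open>Freeze x. By mass 1, T f(x) - f(x) is the value at x of the operator applied to f -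
  f(x), so Jensen's inequality with exponent 2 bounds its square by the kernel average of |f(x) -
  f(y)|^2. This modulus splits into real and imaginary parts.\<close>

lemma kernel_op_diff_energy:
  assumes f: "f \<in> Lp M 2"
  shows "(\<integral>\<^sup>+x. ennreal ((cmod (kernel_op f x - f x))\<^sup>2) \<partial>M)
    \<le> kernel_energy (\<lambda>x. Re (f x)) + kernel_energy (\<lambda>x. Im (f x))"
proof -
  have [measurable]: "f \<in> borel_measurable M" using f by (simp add: Lp_def)
  have "f \<in> L1_plus_Linf M" using f Lp_subset_L1_plus_Linf[of 2 M] by auto
  from AE_kernel_integrable[OF this] AE_space
  have "AE x in M. ennreal ((cmod (kernel_op f x - f x))\<^sup>2)
      \<le> (\<integral>\<^sup>+y. ennreal (k x y) * ennreal ((cmod (f x - f y))\<^sup>2) \<partial>M)"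
  proof eventually_elim
    case (elim x)
    then have [measurable]: "(\<lambda>y. k x y) \<in> borel_measurable M" by measurable
    have k: "integrable M (\<lambda>y. complex_of_real (k x y) * f x)"
      using elim by (subst integrable_kernel_iff) (auto simp: nn_integral_kernel_const)
    have "kernel_op (\<lambda>y. f y - f x) x
        = (LINT y|M. complex_of_real (k x y) * f y - complex_of_real (k x y) * f x)"
      unfolding kernel_op_def by (simp add: algebra_simps)
    also have "\<dots> = kernel_op f x - kernel_op (\<lambda>y. 1) x * f x"
      using elim k by (simp add: kernel_op_def)
    also have "\<dots> = kernel_op f x - f x" using elim by (simp add: kernel_op_one)
    finally show ?case
      using kernel_op_jensen[of x 2 "\<lambda>y. f y - f x"] elim by (simp add: norm_minus_commute)
  qed
  then have "(\<integral>\<^sup>+x. ennreal ((cmod (kernel_op f x - f x))\<^sup>2) \<partial>M)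
      \<le> (\<integral>\<^sup>+x. \<integral>\<^sup>+y. ennreal (k x y) * ennreal ((cmod (f x - f y))\<^sup>2) \<partial>M \<partial>M)"
    by (rule nn_integral_mono_AE)
  also have "\<dots> = kernel_energy (\<lambda>x. Re (f x)) + kernel_energy (\<lambda>x. Im (f x))"
    unfolding kernel_energy_def
    by (simp add: cmod_power2 distrib_left nn_integral_pair_add)
  finally show ?thesis .
qed

end

section \<open>Semigroups of symmetric Markov kernels\<close>

text \<open>Only positive times carry a kernel; the identity at time 0 is added in
  \<open>semigroup_op\<close>.\<close>

locale symmetric_markov_kernel_semigroup = sigma_finite_measure M
  for M :: "'a measure" and k :: "real \<Rightarrow> 'a \<Rightarrow> 'a \<Rightarrow> real" +
  assumes markov_kernel: "0 < t \<Longrightarrow> symmetric_markov_kernel M (k t)"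
    and chapman_kolmogorov: "0 < s \<Longrightarrow> 0 < t \<Longrightarrow> x \<in> space M \<Longrightarrow> y \<in> space M \<Longrightarrow>
      (\<integral>\<^sup>+z. ennreal (k s x z) * ennreal (k t z y) \<partial>M) = ennreal (k (s + t) x y)"
begin

sublocale pair: pair_sigma_finite M M ..

abbreviation op_at :: "real \<Rightarrow> ('a \<Rightarrow> complex) \<Rightarrow> 'a \<Rightarrow> complex" where
  "op_at t \<equiv> symmetric_markov_kernel.kernel_op M (k t)"

abbreviation energy_at :: "real \<Rightarrow> ('a \<Rightarrow> real) \<Rightarrow> ennreal" where
  "energy_at t \<equiv> symmetric_markov_kernel.kernel_energy M (k t)"

text \<open>The integral is written out in the shape of \<open>bessel_semigroup\<close>, so that the
  two operators agree by unfolding.\<close>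

definition semigroup_op :: "real \<Rightarrow> ('a \<Rightarrow> complex) \<Rightarrow> 'a \<Rightarrow> complex" where
  "semigroup_op t f = (if t = 0 then f else (\<lambda>x. LINT y|M. complex_of_real (k t x y) * f y))"

text \<open>Fubini's theorem for k_s(x, z) k_t(z, y) f(y) at a fixed x. Applied to |f|,
  Chapman-Kolmogorov identifies the absolute double integral with the integral of k_{s+t}(x, y)
  |f(y)|, which is finite for almost every x; the same identity then evaluates the inner integral
  over z.\<close>

lemma op_at_compose:
  assumes st: "0 < s" "0 < t" and f: "f \<in> L1_plus_Linf M"
  shows "AE x in M. op_at (s + t) f x = op_at s (op_at t f) x"
proof -
  interpret ks: symmetric_markov_kernel M "k s" using st by (intro markov_kernel)
  interpret kt: symmetric_markov_kernel M "k t" using st by (intro markov_kernel)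
  interpret kst: symmetric_markov_kernel M "k (s + t)" using st by (intro markov_kernel) simp
  have [measurable]: "f \<in> borel_measurable M" using f L1_plus_Linf_measurable by auto
  from kst.AE_kernel_finite[OF f] AE_space show ?thesis
  proof eventually_elim
    case (elim x)
    then have fin: "(\<integral>\<^sup>+y. ennreal (k (s + t) x y) * ennreal (cmod (f y)) \<partial>M) < \<infinity>"
      and x[measurable]: "x \<in> space M" by auto
    define F where "F = (\<lambda>(z, y). complex_of_real (k s x z * k t z y) * f y)"
    have [measurable]: "F \<in> borel_measurable (M \<Otimes>\<^sub>M M)"
      unfolding F_def using x by measurable
    have "(\<integral>\<^sup>+p. ennreal (norm (F p)) \<partial>(M \<Otimes>\<^sub>M M)) = (\<integral>\<^sup>+z. \<integral>\<^sup>+y. ennreal (norm (F (z, y))) \<partial>M \<partial>M)"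
      using nn_integral_fst[of "\<lambda>z. ennreal (norm (F z))" M] by simp
    also have "\<dots> = (\<integral>\<^sup>+y. \<integral>\<^sup>+z. ennreal (norm (F (z, y))) \<partial>M \<partial>M)"
      by (rule pair.Fubini'[symmetric]) measurable
    also have "\<dots> = (\<integral>\<^sup>+y. \<integral>\<^sup>+z. (ennreal (k s x z) * ennreal (k t z y)) * ennreal (cmod (f y)) \<partial>M \<partial>M)"
      by (intro nn_integral_cong)
        (simp add: F_def norm_mult abs_mult ks.kernel_nonneg[OF x] kt.kernel_nonneg ennreal_mult)
    also have "\<dots> = (\<integral>\<^sup>+y. ennreal (k (s + t) x y) * ennreal (cmod (f y)) \<partial>M)"
      using st x by (intro nn_integral_cong) (simp add: nn_integral_multc chapman_kolmogorov)
    finally have F: "integrable (M \<Otimes>\<^sub>M M) F" using fin by (simp add: integrable_iff_bounded)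
    then have "(LINT y|M. LINT z|M. F (z, y)) = (LINT z|M. LINT y|M. F (z, y))"
      using pair.Fubini_integral[of "\<lambda>x y. F (x, y)"] by simp
    moreover have "(LINT y|M. LINT z|M. F (z, y)) = op_at (s + t) f x"
      unfolding kst.kernel_op_def
    proof (intro Bochner_Integration.integral_cong refl)
      fix y assume y[measurable]: "y \<in> space M"
      have "has_bochner_integral M (\<lambda>z. k s x z * k t z y) (k (s + t) x y)"
      proof (rule has_bochner_integral_nn_integral)
        show "(\<lambda>z. k s x z * k t z y) \<in> borel_measurable M" using x y by measurable
        show "AE z in M. 0 \<le> k s x z * k t z y"
          using x y by (intro AE_I2) (simp add: ks.kernel_nonneg kt.kernel_nonneg)
        show "0 \<le> k (s + t) x y" using x y by (rule kst.kernel_nonneg)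
        have "(\<integral>\<^sup>+z. ennreal (k s x z * k t z y) \<partial>M) = (\<integral>\<^sup>+z. ennreal (k s x z) * ennreal (k t z y) \<partial>M)"
          using x y by (intro nn_integral_cong) (simp add: ennreal_mult ks.kernel_nonneg kt.kernel_nonneg)
        then show "(\<integral>\<^sup>+z. ennreal (k s x z * k t z y) \<partial>M) = ennreal (k (s + t) x y)"
          using st x y by (simp add: chapman_kolmogorov)
      qed
      then have "(LINT z|M. complex_of_real (k s x z * k t z y)) = complex_of_real (k (s + t) x y)"
        unfolding integral_complex_of_real by (simp only: has_bochner_integral_integral_eq)
      then show "(LINT z|M. F (z, y)) = complex_of_real (k (s + t) x y) * f y"
        by (simp only: F_def prod.case integral_mult_left_zero)
    qed
    moreover have "(LINT z|M. LINT y|M. F (z, y)) = op_at s (op_at t f) x"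
      by (simp add: F_def ks.kernel_op_def kt.kernel_op_def mult.assoc)
    ultimately show ?case by simp
  qed
qed

section \<open>Functions whose energy vanishes as time tends to 0\<close>

definition energy_vanishes :: "('a \<Rightarrow> real) \<Rightarrow> bool" where
  "energy_vanishes f \<longleftrightarrow> ((\<lambda>t. energy_at t f) \<longlongrightarrow> 0) (at_right 0)"

lemma eventually_pos: "\<forall>\<^sub>F t::real in at_right 0. 0 < t"
  by (simp add: eventually_at_right_less)

lemma energy_vanishes_zero: "energy_vanishes (\<lambda>_. 0)"
proof -
  have "\<forall>\<^sub>F t in at_right 0. energy_at t (\<lambda>_. 0) = 0"
    using eventually_pos
    by eventually_elim (simp add: symmetric_markov_kernel.kernel_energy_def[OF markov_kernel])
  then show ?thesis unfolding energy_vanishes_def by (rule tendsto_eventually)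
qed

lemma energy_vanishes_add:
  assumes [measurable]: "f \<in> borel_measurable M" "g \<in> borel_measurable M"
    and "energy_vanishes f" "energy_vanishes g"
  shows "energy_vanishes (\<lambda>x. f x + g x)"
  unfolding energy_vanishes_def
proof (rule tendsto_sandwich[OF _ _ tendsto_const])
  show "\<forall>\<^sub>F t in at_right 0. energy_at t (\<lambda>x. f x + g x) \<le> 2 * energy_at t f + 2 * energy_at t g"
    using eventually_pos
    by eventually_elim (simp add: symmetric_markov_kernel.kernel_energy_add[OF markov_kernel])
  have "((\<lambda>t. 2 * energy_at t f + 2 * energy_at t g) \<longlongrightarrow> 2 * 0 + 2 * 0) (at_right 0)"
    using assms(3,4) unfolding energy_vanishes_def
    by (intro tendsto_add ennreal_tendsto_cmult) auto
  then show "((\<lambda>t. 2 * energy_at t f + 2 * energy_at t g) \<longlongrightarrow> 0) (at_right 0)" by simp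
qed simp

lemma energy_vanishes_cmult:
  assumes [measurable]: "f \<in> borel_measurable M" and "energy_vanishes f"
  shows "energy_vanishes (\<lambda>x. c * f x)"
proof -
  have "((\<lambda>t. ennreal (c\<^sup>2) * energy_at t f) \<longlongrightarrow> ennreal (c\<^sup>2) * 0) (at_right 0)"
    using assms(2) unfolding energy_vanishes_def by (intro ennreal_tendsto_cmult) auto
  moreover have "\<forall>\<^sub>F t in at_right 0. energy_at t (\<lambda>x. c * f x) = ennreal (c\<^sup>2) * energy_at t f"
    using eventually_pos
    by eventually_elim (simp add: symmetric_markov_kernel.kernel_energy_cmult[OF markov_kernel])
  ultimately show ?thesis unfolding energy_vanishes_def by (simp add: tendsto_cong)
qed

text \<open>The energy of f - u_n is bounded by its squared norm uniformly in time. Hence n can be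
  fixed before t, and only the energy of this one \<open>u n\<close> has to be small near 0.\<close>

lemma energy_vanishes_closed:
  fixes f :: "'a \<Rightarrow> real"
  assumes [measurable]: "f \<in> borel_measurable M" "\<And>n. u n \<in> borel_measurable M"
    and u: "\<And>n::nat. energy_vanishes (u n)"
    and lim: "(\<lambda>n. \<integral>\<^sup>+x. ennreal ((f x - u n x)\<^sup>2) \<partial>M) \<longlonglongrightarrow> 0"
  shows "energy_vanishes f"
  unfolding energy_vanishes_def
proof (rule order_tendstoI)
  fix e :: ennreal assume e: "0 < e"
  \<comment> \<open>The constant is 2 * 4: the factor 2 of \<open>kernel_energy_add\<close> times
    the factor 4 of \<open>kernel_energy_le\<close>.\<close>
  have "(\<lambda>n. 8 * (\<integral>\<^sup>+x. ennreal ((f x - u n x)\<^sup>2) \<partial>M)) \<longlonglongrightarrow> 8 * 0"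
    using lim by (intro ennreal_tendsto_cmult) auto
  then have "(\<lambda>n. 8 * (\<integral>\<^sup>+x. ennreal ((f x - u n x)\<^sup>2) \<partial>M)) \<longlonglongrightarrow> 0" by simp
  from order_tendstoD(2)[OF this e]
  obtain n where n: "8 * (\<integral>\<^sup>+x. ennreal ((f x - u n x)\<^sup>2) \<partial>M) < e"
    by (auto simp: eventually_sequentially)
  define a where "a = 8 * (\<integral>\<^sup>+x. ennreal ((f x - u n x)\<^sup>2) \<partial>M)"
  have "((\<lambda>t. a + 2 * energy_at t (u n)) \<longlongrightarrow> a + 2 * 0) (at_right 0)"
    using u[of n] unfolding energy_vanishes_def
    by (intro tendsto_add tendsto_const ennreal_tendsto_cmult) auto
  then have "\<forall>\<^sub>F t in at_right 0. a + 2 * energy_at t (u n) < e"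
    using n unfolding a_def by (intro order_tendstoD(2)) auto
  with eventually_pos show "\<forall>\<^sub>F t in at_right 0. energy_at t f < e"
  proof eventually_elim
    case (elim t)
    interpret symmetric_markov_kernel M "k t" using elim by (intro markov_kernel)
    have "energy_at t f \<le> 2 * energy_at t (\<lambda>x. f x - u n x) + 2 * energy_at t (u n)"
      using kernel_energy_add[of "\<lambda>x. f x - u n x" "u n"] by simp
    also have "\<dots> \<le> 2 * (4 * (\<integral>\<^sup>+x. ennreal ((f x - u n x)\<^sup>2) \<partial>M)) + 2 * energy_at t (u n)"
      using kernel_energy_le[of "\<lambda>x. f x - u n x"] by (intro add_mono mult_left_mono) auto
    also have "\<dots> = a + 2 * energy_at t (u n)" by (simp add: a_def mult.assoc[symmetric])
    finally show ?case using elim by simp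
  qed
qed simp

lemma energy_vanishes_dominated:
  fixes f g :: "'a \<Rightarrow> real"
  assumes [measurable]: "f \<in> borel_measurable M" "\<And>n. u n \<in> borel_measurable M"
      "g \<in> borel_measurable M"
    and u: "\<And>n::nat. energy_vanishes (u n)"
    and lim: "\<And>x. x \<in> space M \<Longrightarrow> (\<lambda>n. u n x) \<longlonglongrightarrow> f x"
    and bound: "\<And>n x. x \<in> space M \<Longrightarrow> \<bar>f x - u n x\<bar> \<le> g x"
    and g: "(\<integral>\<^sup>+x. ennreal ((g x)\<^sup>2) \<partial>M) < \<infinity>"
  shows "energy_vanishes f"
proof (rule energy_vanishes_closed[OF _ _ u])
  have "(\<lambda>n. \<integral>\<^sup>+x. ennreal ((f x - u n x)\<^sup>2) \<partial>M) \<longlonglongrightarrow> (\<integral>\<^sup>+x. 0 \<partial>M)"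
  proof (rule nn_integral_dominated_convergence[where w = "\<lambda>x. ennreal ((g x)\<^sup>2)"])
    show "AE x in M. ennreal ((f x - u n x)\<^sup>2) \<le> ennreal ((g x)\<^sup>2)" for n
      using bound by (intro AE_I2 ennreal_leI power2_le_iff_abs_le[THEN iffD2]) (auto intro: order_trans[OF abs_ge_zero])
    show "AE x in M. (\<lambda>n. ennreal ((f x - u n x)\<^sup>2)) \<longlonglongrightarrow> 0"
    proof (rule AE_I2)
      fix x assume "x \<in> space M"
      then have "(\<lambda>n. ennreal ((f x - u n x)\<^sup>2)) \<longlonglongrightarrow> ennreal ((f x - f x)\<^sup>2)"
        by (intro tendsto_intros lim)
      then show "(\<lambda>n. ennreal ((f x - u n x)\<^sup>2)) \<longlonglongrightarrow> 0" by simp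
    qed
  qed (use g in \<open>simp_all\<close>)
  then show "(\<lambda>n. \<integral>\<^sup>+x. ennreal ((f x - u n x)\<^sup>2) \<partial>M) \<longlonglongrightarrow> 0" by simp
qed measurable

text \<open>Induction over nonnegative measurable functions, with square integrability as a premise
  inside the induction statement. Summands and increasing approximations inherit it by monotonicity.
  A signed function is the difference of its positive and negative part.\<close>

lemma energy_vanishes_square_integrable:
  assumes ind: "\<And>A. A \<in> sets M \<Longrightarrow> emeasure M A < \<infinity> \<Longrightarrow> energy_vanishes (indicator A)"
    and f[measurable]: "f \<in> borel_measurable M" and fin: "(\<integral>\<^sup>+x. ennreal ((f x)\<^sup>2) \<partial>M) < \<infinity>"
  shows "energy_vanishes f"
proof -
  have nonneg: "(\<integral>\<^sup>+x. ennreal ((u x)\<^sup>2) \<partial>M) < \<infinity> \<longrightarrow> energy_vanishes u"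
    if "u \<in> borel_measurable M" "\<And>x. 0 \<le> u x" for u :: "'a \<Rightarrow> real"
    using that
  proof (induction rule: borel_measurable_induct_real)
    case (set A)
    have "(\<integral>\<^sup>+x. ennreal ((indicator A x :: real)\<^sup>2) \<partial>M) = (\<integral>\<^sup>+x. indicator A x \<partial>M)"
      by (intro nn_integral_cong) (simp split: split_indicator)
    then show ?case using set by (simp add: ind)
  next
    case (mult u c)
    show ?case
    \<comment> \<open>For c = 0 the finiteness for c * u says nothing about u, so the induction
      hypothesis is out of reach and the zero function is handled directly.\<close>
    proof (cases "c = 0")
      case True
      then show ?thesis by (simp add: energy_vanishes_zero)
    next
      case False
      then have "0 < c\<^sup>2" by simp
      then have "(\<integral>\<^sup>+x. ennreal ((u x)\<^sup>2) \<partial>M) < \<infinity>" if "(\<integral>\<^sup>+x. ennreal ((c * u x)\<^sup>2) \<partial>M) < \<infinity>"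
        using that mult(2)
        by (auto simp: power_mult_distrib ennreal_mult nn_integral_cmult ennreal_mult_less_top)
      then show ?thesis using mult by (auto intro: energy_vanishes_cmult)
    qed
  next
    case (add u v)
    have "(\<integral>\<^sup>+x. ennreal ((u x)\<^sup>2) \<partial>M) \<le> (\<integral>\<^sup>+x. ennreal ((v x + u x)\<^sup>2) \<partial>M)"
      "(\<integral>\<^sup>+x. ennreal ((v x)\<^sup>2) \<partial>M) \<le> (\<integral>\<^sup>+x. ennreal ((v x + u x)\<^sup>2) \<partial>M)"
      using add by (intro nn_integral_mono ennreal_leI power_mono; simp)+
    then have "energy_vanishes u" "energy_vanishes v" if "(\<integral>\<^sup>+x. ennreal ((v x + u x)\<^sup>2) \<partial>M) < \<infinity>"
      using that add.IH by (meson order_le_less_trans)+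
    then show ?case using add.hyps by (intro impI energy_vanishes_add)
  next
    case (seq U)
    have le: "U i x \<le> u x" if "x \<in> space M" for i x
      using seq that by (intro incseq_le) (auto simp: incseq_def le_fun_def)
    show ?case
    proof
      assume fin: "(\<integral>\<^sup>+x. ennreal ((u x)\<^sup>2) \<partial>M) < \<infinity>"
      have [measurable]: "\<And>i. U i \<in> borel_measurable M" using seq by auto
      have [measurable]: "u \<in> borel_measurable M"
        by (rule borel_measurable_LIMSEQ_real[of _ U]) (use seq in auto)
      have "(\<integral>\<^sup>+x. ennreal ((U i x)\<^sup>2) \<partial>M) < \<infinity>" for i
        by (rule order_le_less_trans[OF nn_integral_mono fin])
          (use le seq in \<open>auto intro!: ennreal_leI power_mono\<close>)
      then have "energy_vanishes (U i)" for i
        using seq.IH by simp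
      note vanish = this
      show "energy_vanishes u"
      \<comment> \<open>The approximations lie between 0 and u, so u itself dominates the
        error.\<close>
      proof (rule energy_vanishes_dominated[where g = u, OF _ _ _ vanish])
        show "\<bar>u x - U n x\<bar> \<le> u x" if "x \<in> space M" for n x
          using le[OF that, of n] seq.hyps(2)[of n x] by simp
      qed (use seq.hyps(4) fin in simp_all)
    qed
  qed
  have pos: "energy_vanishes (\<lambda>x. max 0 (g x))"
    if [measurable]: "g \<in> borel_measurable M" and "\<And>x. \<bar>g x\<bar> \<le> \<bar>f x\<bar>" for g
  proof -
    have "(max 0 (g x))\<^sup>2 \<le> (f x)\<^sup>2" for x
      using that(2)[of x] by (intro power2_le_iff_abs_le[THEN iffD2] abs_le_square_iff[THEN iffD1]) auto
    then have "(\<integral>\<^sup>+x. ennreal ((max 0 (g x))\<^sup>2) \<partial>M) \<le> (\<integral>\<^sup>+x. ennreal ((f x)\<^sup>2) \<partial>M)"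
      by (intro nn_integral_mono ennreal_leI) auto
    then show ?thesis using fin by (intro nonneg[THEN mp]) auto
  qed
  have "energy_vanishes (\<lambda>x. max 0 (f x) + (-1) * max 0 (- f x))"
    by (intro energy_vanishes_add energy_vanishes_cmult pos) auto
  moreover have "(\<lambda>x. max 0 (f x) + (-1) * max 0 (- f x)) = f" by (auto simp: fun_eq_iff)
  ultimately show ?thesis by simp
qed

text \<open>The sets of a Dynkin system are cut down to a fixed B of finite measure. Complements
  become differences inside B, and the indicator of B, being square integrable, dominates the
  partial sums of a disjoint union.\<close>

lemma energy_vanishes_Dynkin:
  assumes G: "Int_stable G" "G \<subseteq> Pow \<Omega>" and B: "B \<subseteq> \<Omega>" "B \<in> sets M" "emeasure M B < \<infinity>"
    and meas: "\<And>A. A \<in> sigma_sets \<Omega> G \<Longrightarrow> A \<inter> B \<in> sets M"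
    and vanish_B: "energy_vanishes (indicator B)"
    and vanish_G: "\<And>A. A \<in> G \<Longrightarrow> energy_vanishes (indicator (A \<inter> B))"
    and A: "A \<in> sigma_sets \<Omega> G"
  shows "energy_vanishes (indicator (A \<inter> B))"
  using G A
proof (induction rule: sigma_sets_induct_disjoint)
  case (basic A)
  then show ?case by (rule vanish_G)
next
  case empty
  show ?case by (simp add: indicator_def energy_vanishes_zero)
next
  case (compl A)
  have "energy_vanishes (\<lambda>x. indicator B x + (-1) * indicator (A \<inter> B) x)"
    using B vanish_B compl meas by (intro energy_vanishes_add energy_vanishes_cmult) auto
  moreover have "(\<lambda>x. indicator B x + (-1) * indicator (A \<inter> B) x :: real) = indicator ((\<Omega> - A) \<inter> B)"
    using B by (auto simp: fun_eq_iff split: split_indicator)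
  ultimately show ?case by simp
next
  case (union A)
  note [measurable] = B(2)
  have m[measurable]: "A i \<inter> B \<in> sets M" for i using union meas by auto
  have mU[measurable]: "(\<Union>i. A i) \<inter> B \<in> sets M"
  proof -
    have "(\<Union>i. A i) \<inter> B = (\<Union>i. A i \<inter> B)" by blast
    moreover have "(\<Union>i. A i \<inter> B) \<in> sets M" using m by (intro sets.countable_UN) auto
    ultimately show ?thesis by simp
  qed
  have eq: "(\<Sum>i<n. indicator (A i \<inter> B) x) = (indicator (\<Union>i<n. A i \<inter> B) x :: real)" for n x
  proof (rule indicator_UN_disjoint[symmetric])
    show "disjoint_family_on (\<lambda>i. A i \<inter> B) {..<n}"
      using union(1) unfolding disjoint_family_on_def by blast
  qed simp
  have fin: "energy_vanishes (\<lambda>x. \<Sum>i<n. indicator (A i \<inter> B) x)" for n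
  proof (induction n)
    case 0
    show ?case by (simp add: energy_vanishes_zero)
  next
    case (Suc n)
    then show ?case using union(3)[of n] by (auto intro!: energy_vanishes_add)
  qed
  show ?case
  proof (rule energy_vanishes_dominated[where g = "indicator B", OF _ _ _ fin])
    fix x
    have "(\<lambda>n. \<Sum>i<n. indicator (A i \<inter> B) x :: real) \<longlonglongrightarrow> indicator (\<Union>i. A i \<inter> B) x"
      unfolding eq by (rule LIMSEQ_indicator_UN)
    then show "(\<lambda>n. \<Sum>i<n. indicator (A i \<inter> B) x :: real) \<longlonglongrightarrow> indicator (\<Union> (range A) \<inter> B) x"
      by (simp add: Int_UN_distrib2)
    show "\<bar>indicator (\<Union> (range A) \<inter> B) x - (\<Sum>i<n. indicator (A i \<inter> B) x)\<bar> \<le> (indicator B x :: real)" for n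
      unfolding eq by (simp add: indicator_def)
  next
    have "(\<integral>\<^sup>+x. ennreal ((indicator B x :: real)\<^sup>2) \<partial>M) = (\<integral>\<^sup>+x. indicator B x \<partial>M)"
      by (intro nn_integral_cong) (simp split: split_indicator)
    then show "(\<integral>\<^sup>+x. ennreal ((indicator B x :: real)\<^sup>2) \<partial>M) < \<infinity>" using B by simp
  qed measurable
qed

text \<open>Each axiom separates time 0, where the operator is the identity, from positive time,
  where it is a property of one kernel or of the composition of two. Strong continuity is the axiom
  that uses \<open>ind\<close>.\<close>

theorem markovian:
  assumes ind: "\<And>A. A \<in> sets M \<Longrightarrow> emeasure M A < \<infinity> \<Longrightarrow> energy_vanishes (indicator A)"
  shows "markovian_symmetric_diffusion_semigroup M (L1_plus_Linf M) semigroup_op"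
    (is "markovian_symmetric_diffusion_semigroup M ?D ?T")
proof
  have T0[simp]: "?T 0 f = f" for f by (simp add: semigroup_op_def)
  have T: "?T t f = op_at t f" if "0 < t" for t f
    using that by (simp add: fun_eq_iff semigroup_op_def symmetric_markov_kernel.kernel_op_def[OF markov_kernel])
  note meas = L1_plus_Linf_measurable[THEN subsetD]
  show "?D \<subseteq> borel_measurable M" by (rule L1_plus_Linf_measurable)
  show "(\<lambda>x. c * f x + d * g x) \<in> ?D" if "f \<in> ?D" "g \<in> ?D" for f g c d
    using that by (rule L1_plus_Linf_linear)
  show "g \<in> ?D" if "f \<in> ?D" "g \<in> borel_measurable M" "AE x in M. f x = g x" for f g
    using that by (rule L1_plus_Linf_cong_AE)
  show "Lp M p \<subseteq> ?D" if "1 \<le> p" for p using that by (rule Lp_subset_L1_plus_Linf)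
  show "?T t f \<in> borel_measurable M" if "0 \<le> t" "f \<in> ?D" for t f
  proof (cases "t = 0")
    case False
    then have t: "0 < t" using that by simp
    show ?thesis unfolding T[OF t]
      by (rule symmetric_markov_kernel.kernel_op_measurable[OF markov_kernel[OF t] meas[OF that(2)]])
  qed (use meas[OF that(2)] in simp)
  show "AE x in M. ?T t f x = ?T t g x"
    if "0 \<le> t" "f \<in> ?D" "g \<in> ?D" "AE x in M. f x = g x" for t f g
  proof (cases "t = 0")
    case False
    then have t: "0 < t" using that by simp
    show ?thesis unfolding T[OF t]
      by (intro AE_I2 symmetric_markov_kernel.kernel_op_cong_AE[OF markov_kernel[OF t]
          meas[OF that(2)] meas[OF that(3)] that(4)])
  qed (simp add: that)
  show "AE x in M. ?T t (\<lambda>y. c * f y + d * g y) x = c * ?T t f x + d * ?T t g x"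
    if "0 \<le> t" "f \<in> ?D" "g \<in> ?D" for t f g c d
  proof (cases "t = 0")
    case False
    then have t: "0 < t" using that by simp
    show ?thesis unfolding T[OF t]
      by (rule symmetric_markov_kernel.kernel_op_linear[OF markov_kernel[OF t] that(2,3)])
  qed simp
  show "AE x in M. ?T 0 f x = f x" for f by simp
  show contr: "?T t f \<in> Lp M p \<and> Lp_norm M p (?T t f) \<le> Lp_norm M p f"
    if "0 \<le> t" "1 \<le> p" "f \<in> Lp M p" for t p f
  proof (cases "t = 0")
    case False
    then have t: "0 < t" using that by simp
    show ?thesis unfolding T[OF t]
      by (rule symmetric_markov_kernel.kernel_op_contraction[OF markov_kernel[OF t] that(2,3)])
  qed (simp add: that)
  show "AE x in M. ?T (s + t) f x = ?T s (?T t f) x"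
    if "0 \<le> s" "0 \<le> t" "1 \<le> p" "f \<in> Lp M p" for s t p f
  proof (cases "s = 0 \<or> t = 0")
    case True
    then show ?thesis by (elim disjE) simp_all
  next
    case False
    then have st: "0 < s" "0 < t" "0 < s + t" using that by auto
    show ?thesis unfolding T[OF st(1)] T[OF st(2)] T[OF st(3)]
      by (rule op_at_compose[OF st(1,2) Lp_subset_L1_plus_Linf[OF that(3), THEN subsetD, OF that(4)]])
  qed
  show "(LINT x|M. ?T t f x * cnj (g x)) = (LINT x|M. f x * cnj (?T t g x))"
    if "0 \<le> t" "f \<in> Lp M 2" "g \<in> Lp M 2" for t f g
  proof (cases "t = 0")
    case False
    then have t: "0 < t" using that by simp
    show ?thesis unfolding T[OF t]
      by (rule symmetric_markov_kernel.kernel_op_self_adjoint[OF markov_kernel[OF t] that(2,3)])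
  qed simp
  show "((\<lambda>t. Lp_norm M 2 (\<lambda>x. ?T t f x - f x)) \<longlongrightarrow> 0) (at_right 0)" if f: "f \<in> Lp M 2" for f
  \<comment> \<open>The squared norm is squeezed between 0 and the energies of the real and
    imaginary parts, whose squares are dominated by |f|^2.\<close>
  proof (rule tendsto_Lp_norm_2_zero, rule tendsto_sandwich[OF _ _ tendsto_const])
    have [measurable]: "f \<in> borel_measurable M" and fin: "(\<integral>\<^sup>+x. ennreal ((cmod (f x))\<^sup>2) \<partial>M) < \<infinity>"
      using f by (auto simp: Lp_2_iff)
    have vanish: "energy_vanishes g" if "g \<in> borel_measurable M" "\<And>x. (g x)\<^sup>2 \<le> (cmod (f x))\<^sup>2" for g
    proof (rule energy_vanishes_square_integrable[OF ind that(1)])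
      have "(\<integral>\<^sup>+x. ennreal ((g x)\<^sup>2) \<partial>M) \<le> (\<integral>\<^sup>+x. ennreal ((cmod (f x))\<^sup>2) \<partial>M)"
        using that(2) by (intro nn_integral_mono ennreal_leI)
      then show "(\<integral>\<^sup>+x. ennreal ((g x)\<^sup>2) \<partial>M) < \<infinity>" using fin by (rule order_le_less_trans)
    qed
    have "energy_vanishes (\<lambda>x. Re (f x))" "energy_vanishes (\<lambda>x. Im (f x))"
      by (rule vanish; simp add: cmod_power2)+
    then have "((\<lambda>t. energy_at t (\<lambda>x. Re (f x)) + energy_at t (\<lambda>x. Im (f x))) \<longlongrightarrow> 0 + 0) (at_right 0)"
      unfolding energy_vanishes_def by (intro tendsto_add)
    then show "((\<lambda>t. energy_at t (\<lambda>x. Re (f x)) + energy_at t (\<lambda>x. Im (f x))) \<longlongrightarrow> 0) (at_right 0)"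
      by simp
    show "\<forall>\<^sub>F t in at_right 0. (\<integral>\<^sup>+x. ennreal ((cmod (?T t f x - f x))\<^sup>2) \<partial>M)
        \<le> energy_at t (\<lambda>x. Re (f x)) + energy_at t (\<lambda>x. Im (f x))"
      using eventually_pos
    proof eventually_elim
      case (elim t)
      show ?case unfolding T[OF elim]
        by (rule symmetric_markov_kernel.kernel_op_diff_energy[OF markov_kernel[OF elim] f])
    qed
  qed simp
  show "AE x in M. ?T t f x \<in> \<real>\<^sub>\<ge>\<^sub>0"
    if "0 \<le> t" "f \<in> ?D" "AE x in M. f x \<in> \<real>\<^sub>\<ge>\<^sub>0" for t f
  proof (cases "t = 0")
    case False
    then have t: "0 < t" using that by simp
    show ?thesis unfolding T[OF t]
      by (intro AE_I2 symmetric_markov_kernel.kernel_op_positive[OF markov_kernel[OF t] meas[OF that(2)] that(3)])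
  qed (simp add: that)
  show "AE x in M. ?T t (\<lambda>_. 1) x = 1" if "0 \<le> t" for t
  proof (cases "t = 0")
    case False
    then have t: "0 < t" using that by simp
    show ?thesis unfolding T[OF t]
      by (intro AE_I2 symmetric_markov_kernel.kernel_op_one[OF markov_kernel[OF t]])
  qed simp
qed

end

section \<open>Series and integrals\<close>

text \<open>A series is an integral over counting measure, so this is the exchange of sum and
  integral for nonnegative terms.\<close>

lemma suminf_ennreal_commute:
  fixes f :: "nat \<Rightarrow> nat \<Rightarrow> ennreal"
  shows "(\<Sum>i. \<Sum>j. f i j) = (\<Sum>j. \<Sum>i. f i j)"
  using nn_integral_suminf[of "\<lambda>i j. f i j" "count_space UNIV"]
  by (simp add: nn_integral_count_space_nat)

text \<open>Both sides are the rising factorial c (c + 1) ... (c + m - 1) divided by m!.\<close>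

lemma gbinomial_Gamma:
  fixes c :: real
  assumes "0 < c"
  shows "(c + real m - 1) gchoose m = Gamma (c + m) * rGamma c / fact m"
proof -
  have "c \<notin> \<int>\<^sub>\<le>\<^sub>0" using assms by (auto elim!: nonpos_Ints_cases)
  then have "pochhammer c m = Gamma (c + m) / Gamma c" by (rule pochhammer_Gamma)
  then show ?thesis by (simp add: gbinomial_pochhammer' rGamma_inverse_Gamma field_simps)
qed

text \<open>Vandermonde's identity: the products of binomials (j over n) and (\<nu> + k - 1 over k -
  n) sum to (\<nu> + j + k - 1 over k). Multiplying by \<open>rGamma (\<nu> + k) / fact j\<close>
  gives the claim, and the guard on n reflects that (j over n) is 0 for n > j.\<close>

lemma bessel_coefficient_Vandermonde:
  fixes \<nu> :: real
  assumes "0 < \<nu>"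
  shows "(\<Sum>n\<le>k. if n \<le> j then rGamma (\<nu> + n) / (fact n * fact (j - n) * fact (k - n)) else 0)
    = Gamma (\<nu> + j + k) * rGamma (\<nu> + j) * rGamma (\<nu> + k) / (fact j * fact k)"
proof -
  have G: "Gamma (\<nu> + k) * rGamma (\<nu> + k) = 1"
    using assms by (simp add: rGamma_inverse_Gamma Gamma_real_pos less_imp_neq[symmetric] add_pos_nonneg)
  have "(\<Sum>n\<le>k. (real j gchoose n) * ((\<nu> + k - 1) gchoose (k - n))) = (real j + (\<nu> + k - 1)) gchoose k"
    using gbinomial_Vandermonde[of "real j" "\<nu> + k - 1" k] by (simp add: atMost_atLeast0)
  also have "\<dots> = Gamma (\<nu> + j + k) * rGamma (\<nu> + j) / fact k"
    using gbinomial_Gamma[of "\<nu> + j" k] assms by (simp add: algebra_simps)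
  finally have "Gamma (\<nu> + j + k) * rGamma (\<nu> + j) * rGamma (\<nu> + k) / (fact j * fact k)
    = (\<Sum>n\<le>k. (real j gchoose n) * ((\<nu> + k - 1) gchoose (k - n))) * rGamma (\<nu> + k) / fact j"
    by simp
  also have "\<dots> = (\<Sum>n\<le>k. (real j gchoose n) * ((\<nu> + k - 1) gchoose (k - n)) * rGamma (\<nu> + k) / fact j)"
    by (simp add: sum_distrib_right sum_divide_distrib)
  also have "\<dots> = (\<Sum>n\<le>k. if n \<le> j then rGamma (\<nu> + n) / (fact n * fact (j - n) * fact (k - n)) else 0)"
  proof (intro sum.cong refl)
    fix n assume n: "n \<in> {..k}"
    have "((\<nu> + k - 1) gchoose (k - n)) = Gamma (\<nu> + k) * rGamma (\<nu> + n) / fact (k - n)"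
      using gbinomial_Gamma[of "\<nu> + n" "k - n"] assms n by (simp add: of_nat_diff algebra_simps)
    then have "((\<nu> + k - 1) gchoose (k - n)) * rGamma (\<nu> + k) = rGamma (\<nu> + n) / fact (k - n)"
      using G by (simp add: field_simps) (metis mult.commute mult.assoc mult_1)
    moreover have "(real j gchoose n) / fact j = (if n \<le> j then 1 / (fact n * fact (j - n)) else 0)"
      by (simp add: binomial_gbinomial[symmetric] binomial_fact)
    ultimately show "(real j gchoose n) * ((\<nu> + k - 1) gchoose (k - n)) * rGamma (\<nu> + k) / fact j
      = (if n \<le> j then rGamma (\<nu> + n) / (fact n * fact (j - n) * fact (k - n)) else 0)"
      by (simp add: divide_simps split: if_splits) (simp add: mult_ac)?
  qed
  finally show ?thesis by simp
qed

lemma rGamma_real_nonneg: "0 < x \<Longrightarrow> 0 \<le> rGamma (x::real)"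
  by (simp add: rGamma_inverse_Gamma Gamma_real_pos less_imp_le)

text \<open>The exponential series moved by n places. The guard keeps the truncated difference
  \<open>j - n\<close> from contributing for j < n.\<close>

lemma shifted_exp_sums:
  fixes a :: real
  shows "(\<lambda>j. if n \<le> j then a ^ j / fact (j - n) else 0) sums (a ^ n * exp a)"
proof -
  have "(\<lambda>i. a ^ n * (a ^ i /\<^sub>R fact i)) sums (a ^ n * exp a)"
    by (intro sums_mult exp_converges)
  then have "(\<lambda>i. (\<lambda>j. if n \<le> j then a ^ j / fact (j - n) else 0) (i + n)) sums (a ^ n * exp a)"
    by (simp add: power_add field_simps)
  then show ?thesis by (subst (asm) sums_zero_iff_shift) auto
qed

text \<open>The series form of Weber's second exponential integral, which integrates a Gaussian
  against two modified Bessel functions. Vandermonde adds a third index n; for fixed n the sums over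
  j and k separate into shifted exponential series with values a^n e^a and b^n e^b. Nonnegative
  terms allow every reordering.\<close>

lemma bessel_double_series:
  fixes \<nu> a b :: real
  assumes \<nu>: "0 < \<nu>" and ab: "0 \<le> a" "0 \<le> b"
  shows "(\<Sum>j. \<Sum>k. ennreal (a ^ j * b ^ k * (Gamma (\<nu> + j + k) * rGamma (\<nu> + j) * rGamma (\<nu> + k) / (fact j * fact k))))
    = (\<Sum>n. ennreal (exp (a + b) * ((a * b) ^ n * rGamma (\<nu> + n) / fact n)))"
proof -
  define P where "P n j c = (if n \<le> j then c ^ j / fact (j - n) else 0)" for n j and c :: real
  define Q where "Q n = rGamma (\<nu> + real n) / fact n" for n
  have P: "0 \<le> P n j c" if "0 \<le> c" for n j c using that by (simp add: P_def)
  have Q: "0 \<le> Q n" for n using \<nu> by (simp add: Q_def rGamma_real_nonneg)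
  have "a ^ j * b ^ k * (Gamma (\<nu> + j + k) * rGamma (\<nu> + j) * rGamma (\<nu> + k) / (fact j * fact k))
      = (\<Sum>n\<le>k. Q n * P n j a * P n k b)" for j k
    unfolding bessel_coefficient_Vandermonde[OF \<nu>, symmetric] sum_distrib_left
    by (intro sum.cong refl) (simp add: P_def Q_def mult_ac)
  moreover have "ennreal (\<Sum>n\<le>k. Q n * P n j a * P n k b) = (\<Sum>n. ennreal (Q n * P n j a * P n k b))" for j k
  proof -
    \<comment> \<open>\<open>P n k b\<close> is 0 for n > k, so the finite sum extends to a full
      series whose range no longer depends on k.\<close>
    have "(\<Sum>n. ennreal (Q n * P n j a * P n k b)) = (\<Sum>n\<le>k. ennreal (Q n * P n j a * P n k b))"
      by (rule suminf_finite) (auto simp: P_def)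
    also have "\<dots> = ennreal (\<Sum>n\<le>k. Q n * P n j a * P n k b)"
      using P Q ab by (intro sum_ennreal) auto
    finally show ?thesis by simp
  qed
  ultimately have "(\<Sum>j. \<Sum>k. ennreal (a ^ j * b ^ k * (Gamma (\<nu> + j + k) * rGamma (\<nu> + j) * rGamma (\<nu> + k) / (fact j * fact k))))
      = (\<Sum>j. \<Sum>k. \<Sum>n. ennreal (Q n * P n j a * P n k b))" by simp
  also have "\<dots> = (\<Sum>j. \<Sum>n. \<Sum>k. ennreal (Q n * P n j a * P n k b))"
    by (subst suminf_ennreal_commute) simp
  also have "\<dots> = (\<Sum>n. \<Sum>j. \<Sum>k. ennreal (Q n * P n j a * P n k b))"
    by (rule suminf_ennreal_commute)
  also have "\<dots> = (\<Sum>n. ennreal (Q n * (a ^ n * exp a) * (b ^ n * exp b)))"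
  proof (intro arg_cong[where f = suminf] ext)
    fix n
    have "(\<Sum>k. ennreal (Q n * P n j a * P n k b)) = ennreal (Q n * P n j a * (b ^ n * exp b))" for j
      using P Q ab unfolding P_def[of n _ b]
      by (intro suminf_ennreal_eq sums_mult shifted_exp_sums) (auto simp: P_def[symmetric])
    moreover have "(\<Sum>j. ennreal (Q n * P n j a * (b ^ n * exp b))) = ennreal (Q n * (a ^ n * exp a) * (b ^ n * exp b))"
      using P Q ab unfolding P_def[of n _ a]
      by (intro suminf_ennreal_eq sums_mult sums_mult2 shifted_exp_sums) (auto simp: P_def[symmetric])
    ultimately show "(\<Sum>j. \<Sum>k. ennreal (Q n * P n j a * P n k b)) = ennreal (Q n * (a ^ n * exp a) * (b ^ n * exp b))"
      by simp
  qed
  also have "\<dots> = (\<Sum>n. ennreal (exp (a + b) * ((a * b) ^ n * rGamma (\<nu> + n) / fact n)))"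
    by (simp add: Q_def exp_add power_mult_distrib mult_ac)
  finally show ?thesis .
qed

text \<open>For nonnegative A these are the total mass and the first two factorial moments of the
  Poisson law with mean A. Each is the exponential series shifted by 0, 1 or 2.\<close>

lemma poisson_sums:
  fixes A :: real
  shows "(\<lambda>k. exp (- A) * A ^ k / fact k) sums 1"
    and "(\<lambda>k. real k * (exp (- A) * A ^ k / fact k)) sums A"
    and "(\<lambda>k. real k * (real k - 1) * (exp (- A) * A ^ k / fact k)) sums A\<^sup>2"
proof -
  have shift: "(\<lambda>k. if n \<le> k then exp (- A) * (A ^ k / fact (k - n)) else 0) sums (A ^ n)" for n
  proof -
    have "(\<lambda>k. exp (- A) * (if n \<le> k then A ^ k / fact (k - n) else 0)) sums (exp (- A) * (A ^ n * exp A))"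
      by (intro sums_mult shifted_exp_sums)
    moreover have "exp (- A) * (A ^ n * exp A) = A ^ n" by (simp add: exp_minus)
    moreover have "(\<lambda>k. exp (- A) * (if n \<le> k then A ^ k / fact (k - n) else 0))
        = (\<lambda>k. if n \<le> k then exp (- A) * (A ^ k / fact (k - n)) else 0)" by auto
    ultimately show ?thesis by simp
  qed
  show "(\<lambda>k. exp (- A) * A ^ k / fact k) sums 1" using shift[of 0] by simp
  have "real k * (exp (- A) * A ^ k / fact k) = (if 1 \<le> k then exp (- A) * (A ^ k / fact (k - 1)) else 0)" for k
    by (cases k) (auto simp: divide_simps simp del: of_nat_Suc)
  then show "(\<lambda>k. real k * (exp (- A) * A ^ k / fact k)) sums A" using shift[of 1] by simp
  have "real k * (real k - 1) * (exp (- A) * A ^ k / fact k) = (if 2 \<le> k then exp (- A) * (A ^ k / fact (k - 2)) else 0)" for k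
  proof (cases "2 \<le> k")
    case True
    then obtain m where k: "k = Suc (Suc m)" by (metis add_2_eq_Suc le_Suc_ex)
    have "real (Suc (Suc m)) - 1 = real (Suc m)" by simp
    then show ?thesis unfolding k by (simp add: divide_simps del: of_nat_Suc)
  next
    case False
    then have "k = 0 \<or> k = 1" by auto
    then show ?thesis by auto
  qed
  then show "(\<lambda>k. real k * (real k - 1) * (exp (- A) * A ^ k / fact k)) sums A\<^sup>2" using shift[of 2] by simp
qed

lemma summable_bessel:
  fixes \<nu> z :: real
  assumes "0 < \<nu>"
  shows "summable (\<lambda>k. z ^ k * rGamma (\<nu> + real k) / fact k)"
proof (rule summable_ratio_test[where c = "1/2"])
  \<comment> \<open>The ratio of consecutive terms is z / ((k + 1) (\<nu> + k)). From
    \<open>N\<close> on, k + 1 is at least 2 |z| and \<nu> + k is at least 1, which makes the ratio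
    at most 1/2.\<close>
  define N where "N = Suc (nat \<lceil>2 * \<bar>z\<bar>\<rceil>)"
  fix k assume "N \<le> k"
  then have k: "2 * \<bar>z\<bar> \<le> real k" "1 \<le> real k" unfolding N_def by linarith+
  have "(\<nu> + k) * rGamma (\<nu> + k + 1) = rGamma (\<nu> + k)" by (rule rGamma_plus1)
  then have R: "rGamma (\<nu> + k) = (\<nu> + k) * rGamma (\<nu> + real (Suc k))" by (simp add: add_ac)
  have "2 * \<bar>z\<bar> * 1 \<le> (real k + 1) * (\<nu> + k)"
    using k assms by (intro mult_mono) auto
  then have "2 * \<bar>z\<bar> * (\<bar>z\<bar> ^ k * \<bar>rGamma (\<nu> + real (Suc k))\<bar>)
      \<le> (real k + 1) * (\<nu> + k) * (\<bar>z\<bar> ^ k * \<bar>rGamma (\<nu> + real (Suc k))\<bar>)"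
    by (intro mult_right_mono) auto
  then show "norm (z ^ Suc k * rGamma (\<nu> + real (Suc k)) / fact (Suc k))
      \<le> 1 / 2 * norm (z ^ k * rGamma (\<nu> + real k) / fact k)"
    unfolding R using assms
    by (simp add: abs_mult power_abs divide_simps del: of_nat_Suc) (simp add: algebra_simps)
qed simp

text \<open>Substitute u = w y^2 in the Gamma integral. The Jacobian 2 w y and the factor (w
  y^2)^(a-1) combine to 2 w^a y^(2a-1).\<close>

lemma gaussian_moment:
  fixes a w :: real
  assumes a: "0 < a" and w: "0 < w"
  shows "(\<integral>\<^sup>+y. ennreal (indicator {0<..} y * (y powr (2 * a - 1) * exp (- (w * y\<^sup>2)))) \<partial>lborel)
    = ennreal (Gamma a / (2 * w powr a))"
proof -
  let ?f = "\<lambda>u::real. u powr (a - 1) / exp u"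
  let ?g = "\<lambda>y::real. w * y\<^sup>2"
  have img: "?g ` {0<..} = {0<..}"
  proof (intro equalityI subsetI)
    fix u :: real assume "u \<in> {0<..}"
    then show "u \<in> ?g ` {0<..}" using w by (intro image_eqI[of _ _ "sqrt (u / w)"]) auto
  qed (use w in auto)
  \<comment> \<open>The endpoint 0 is a null set; the open half-line is mapped bijectively to itself
    by the substitution.\<close>
  have "(?f has_integral Gamma a) {0<..}"
    using Gamma_integral_real[OF a]
    by (rule has_integral_spike_set_eq[THEN iffD1, rotated -1]) (auto intro: negligible_subset[of "{0}"])
  moreover from this have "?f absolutely_integrable_on {0<..}"
    by (intro nonnegative_absolutely_integrable_1) auto
  ultimately have "?f absolutely_integrable_on ?g ` {0<..} \<and> integral (?g ` {0<..}) ?f = Gamma a"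
    unfolding img by (simp add: integral_unique)
  moreover have "(?g has_field_derivative 2 * w * y) (at y within {0<..})" for y
    by (auto intro!: derivative_eq_intros)
  moreover have "inj_on ?g {0<..}"
    using w by (auto simp: inj_on_def power2_eq_iff)
  ultimately have "(\<lambda>y. \<bar>2 * w * y\<bar> * ?f (?g y)) absolutely_integrable_on {0<..} \<and>
      integral {0<..} (\<lambda>y. \<bar>2 * w * y\<bar> * ?f (?g y)) = Gamma a"
    by (subst has_absolute_integral_change_of_variables_1'[where g = ?g and g' = "\<lambda>y. 2 * w * y"]) simp_all
  then have "((\<lambda>y. \<bar>2 * w * y\<bar> * ?f (?g y)) has_integral Gamma a) {0<..}"
    by (auto simp: has_integral_integrable_integral dest: absolutely_integrable_on_def[THEN iffD1])
  then have "((\<lambda>y. 1 / (2 * w powr a) * (\<bar>2 * w * y\<bar> * ?f (?g y))) has_integral 1 / (2 * w powr a) * Gamma a) {0<..}"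
    by (rule has_integral_mult_right)
  then have I: "((\<lambda>y. y powr (2 * a - 1) * exp (- (w * y\<^sup>2))) has_integral Gamma a / (2 * w powr a)) {0<..}"
  proof (rule has_integral_eq_rhs[OF has_integral_eq, rotated])
    fix y :: real assume "y \<in> {0<..}"
    then have y: "0 < y" by simp
    have "y\<^sup>2 powr (a - 1) = y powr (2 * (a - 1))"
      using y by (simp add: powr_powr flip: powr_numeral)
    moreover have "y * y powr (2 * (a - 1)) = y powr (2 * a - 1)"
      using y by (simp add: powr_mult_base algebra_simps)
    moreover have "w * w powr (a - 1) = w powr a" using w by (simp add: powr_mult_base)
    moreover have "w * y * (w * y\<^sup>2) powr (a - 1) = (w * w powr (a - 1)) * (y * y\<^sup>2 powr (a - 1))"
      using w by (simp add: powr_mult mult_ac)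
    ultimately have "w * y * (w * y\<^sup>2) powr (a - 1) = w powr a * y powr (2 * a - 1)" by simp
    then show "1 / (2 * w powr a) * (\<bar>2 * w * y\<bar> * ?f (?g y)) = y powr (2 * a - 1) * exp (- (w * y\<^sup>2))"
      using y w by (simp add: exp_minus divide_simps mult_ac)
  qed simp
  show ?thesis by (rule nn_integral_has_integral_lebesgue[OF _ I]) auto
qed

section \<open>The Bessel kernel\<close>

lemma space_bessel_measure[simp]: "space (bessel_measure \<alpha>) = {0<..}"
  by (simp add: bessel_measure_def space_restrict_space)

lemma sets_bessel_measure: "sets (bessel_measure \<alpha>) = sets (restrict_space borel {0<..})"
  by (simp add: bessel_measure_def cong: sets_restrict_space_cong)

lemma measurable_bessel_borel:
  assumes "f \<in> borel_measurable borel"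
  shows "f \<in> borel_measurable (bessel_measure \<alpha>)"
  using measurable_restrict_space1[OF assms, of "{0<..}"]
  by (simp cong: measurable_cong_sets add: sets_bessel_measure)

lemma measurable_bessel_ident[measurable]: "(\<lambda>x. x) \<in> bessel_measure \<alpha> \<rightarrow>\<^sub>M borel"
  by (rule measurable_bessel_borel) simp

lemma nn_integral_bessel:
  assumes [measurable]: "f \<in> borel_measurable borel"
  shows "(\<integral>\<^sup>+y. f y \<partial>bessel_measure \<alpha>)
    = (\<integral>\<^sup>+y. ennreal (indicator {0<..} y * y powr (2 * \<alpha> + 1)) * f y \<partial>lborel)"
proof -
  have "(\<integral>\<^sup>+y. f y \<partial>bessel_measure \<alpha>)
      = (\<integral>\<^sup>+y. ennreal (y powr (2 * \<alpha> + 1)) * f y \<partial>restrict_space lborel {0<..})"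
    unfolding bessel_measure_def by (intro nn_integral_density measurable_restrict_space1) simp_all
  also have "\<dots> = (\<integral>\<^sup>+y. ennreal (y powr (2 * \<alpha> + 1)) * f y * indicator {0<..} y \<partial>lborel)"
    by (simp add: nn_integral_restrict_space)
  also have "\<dots> = (\<integral>\<^sup>+y. ennreal (indicator {0<..} y * y powr (2 * \<alpha> + 1)) * f y \<partial>lborel)"
    by (intro nn_integral_cong) (simp split: split_indicator)
  finally show ?thesis .
qed

lemma sigma_finite_bessel_measure: "sigma_finite_measure (bessel_measure \<alpha>)"
proof -
  interpret L: sigma_finite_measure "restrict_space lborel {0<..} :: real measure"
    by (intro sigma_finite_measure_restrict_space lborel.sigma_finite_measure_axioms) simp
  have "(\<lambda>x. ennreal (x powr (2 * \<alpha> + 1))) \<in> borel_measurable (restrict_space lborel {0<..})"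
    by (intro measurable_restrict_space1) simp
  then show ?thesis
    unfolding bessel_measure_def by (subst L.sigma_finite_iff_density_finite) simp_all
qed

text \<open>With the density y^(2\<alpha>+1) this is \<open>gaussian_moment\<close> for a = \<alpha>
  + 1 + n, positive because \<alpha> > -1.\<close>

lemma bessel_gaussian_moment:
  assumes \<alpha>: "-1 < \<alpha>" and w: "0 < w"
  shows "has_bochner_integral (bessel_measure \<alpha>) (\<lambda>y. y ^ (2 * n) * exp (- (w * y\<^sup>2)))
    (Gamma (\<alpha> + 1 + n) / (2 * w powr (\<alpha> + 1 + n)))"
proof (rule has_bochner_integral_nn_integral)
  have [measurable]: "(\<lambda>y. y ^ (2 * n) * exp (- (w * y\<^sup>2))) \<in> borel_measurable borel" by simp
  then show "(\<lambda>y. y ^ (2 * n) * exp (- (w * y\<^sup>2))) \<in> borel_measurable (bessel_measure \<alpha>)"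
    by (rule measurable_bessel_borel)
  have pos: "0 < \<alpha> + 1 + n" using \<alpha> by simp
  then show "0 \<le> Gamma (\<alpha> + 1 + n) / (2 * w powr (\<alpha> + 1 + n))"
    by (simp add: Gamma_real_pos less_imp_le)
  have "(\<integral>\<^sup>+y. ennreal (y ^ (2 * n) * exp (- (w * y\<^sup>2))) \<partial>bessel_measure \<alpha>)
      = (\<integral>\<^sup>+y. ennreal (indicator {0<..} y * y powr (2 * \<alpha> + 1)) * ennreal (y ^ (2 * n) * exp (- (w * y\<^sup>2))) \<partial>lborel)"
    by (rule nn_integral_bessel) simp
  also have "\<dots> = (\<integral>\<^sup>+y. ennreal (indicator {0<..} y * (y powr (2 * (\<alpha> + 1 + n) - 1) * exp (- (w * y\<^sup>2)))) \<partial>lborel)"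
  proof (intro nn_integral_cong)
    fix y :: real
    have "y powr (2 * \<alpha> + 1) * y ^ (2 * n) = y powr (2 * (\<alpha> + 1 + n) - 1)" if "0 < y"
    proof -
      have "y ^ (2 * n) = y powr real (2 * n)" using that by (rule powr_realpow[symmetric])
      then show ?thesis by (simp add: powr_add[symmetric] algebra_simps)
    qed
    then show "ennreal (indicator {0<..} y * y powr (2 * \<alpha> + 1)) * ennreal (y ^ (2 * n) * exp (- (w * y\<^sup>2)))
      = ennreal (indicator {0<..} y * (y powr (2 * (\<alpha> + 1 + n) - 1) * exp (- (w * y\<^sup>2))))"
      by (simp add: ennreal_mult[symmetric] mult.assoc[symmetric] split: split_indicator)
  qed
  also have "\<dots> = ennreal (Gamma (\<alpha> + 1 + n) / (2 * w powr (\<alpha> + 1 + n)))"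
    by (rule gaussian_moment[OF pos w])
  finally show "(\<integral>\<^sup>+y. ennreal (y ^ (2 * n) * exp (- (w * y\<^sup>2))) \<partial>bessel_measure \<alpha>)
    = ennreal (Gamma (\<alpha> + 1 + n) / (2 * w powr (\<alpha> + 1 + n)))" .
qed simp

section \<open>Series expansion, mass and second moment of the Bessel kernel\<close>

lemma nn_integral_bessel_gaussian:
  assumes "-1 < \<alpha>" "0 < w"
  shows "(\<integral>\<^sup>+y. ennreal (y ^ (2 * n) * exp (- (w * y\<^sup>2))) \<partial>bessel_measure \<alpha>)
    = ennreal (Gamma (\<alpha> + 1 + n) / (2 * w powr (\<alpha> + 1 + n)))"
  using bessel_gaussian_moment[OF assms, of n]
  by (subst nn_integral_eq_integral) (auto simp: has_bochner_integral_iff)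

text \<open>The coefficient of y^(2k) exp(-y^2 / (4t)) in the kernel seen as a function of y. It is
  a Poisson probability up to the normalising constant of the corresponding Gaussian moment.\<close>

definition bessel_weight :: "real \<Rightarrow> real \<Rightarrow> real \<Rightarrow> nat \<Rightarrow> real" where
  "bessel_weight \<alpha> t x k = (4 * t) powr (- \<alpha>) / (2 * t) * exp (- (x\<^sup>2 / (4 * t)))
    * ((x\<^sup>2 / (16 * t\<^sup>2)) ^ k * rGamma (\<alpha> + 1 + k) / fact k)"

lemma bessel_weight_nonneg:
  assumes "-1 < \<alpha>" "0 < t"
  shows "0 \<le> bessel_weight \<alpha> t x k"
  using assms by (simp add: bessel_weight_def rGamma_real_nonneg)

text \<open>The power u^\<alpha> in front of the Bessel series cancels (xy)^(-\<alpha>) up to the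
  constant (4t)^(-\<alpha>), leaving only even powers of y.\<close>

lemma bessel_kernel_sums:
  assumes \<alpha>: "-1 < \<alpha>" and pos: "0 < t" "0 < x" "0 < y"
  shows "(\<lambda>k. bessel_weight \<alpha> t x k * (y ^ (2 * k) * exp (- (1 / (4 * t) * y\<^sup>2)))) sums bessel_kernel \<alpha> t x y"
proof -
  \<comment> \<open>Half of the Bessel argument xy / (2t), since the series runs in powers of the
    half argument.\<close>
  define u where "u = x * y / (4 * t)"
  have u: "0 < u" using pos by (simp add: u_def)
  define S where "S = (\<Sum>k. (u\<^sup>2) ^ k * rGamma (\<alpha> + 1 + real k) / fact k)"
  have S: "(\<lambda>k. (u\<^sup>2) ^ k * rGamma (\<alpha> + 1 + real k) / fact k) sums S"
    unfolding S_def using \<alpha> by (intro summable_sums summable_bessel) simp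
  have "u powr (2 * real k) = (u\<^sup>2) ^ k" for k
    using powr_realpow[OF u, of "2 * k"] by (simp only: power_mult of_nat_mult of_nat_numeral)
  then have "u powr (2 * real k + \<alpha>) = u powr \<alpha> * (u\<^sup>2) ^ k" for k
    by (simp only: powr_add mult.commute)
  then have "bessel_I \<alpha> (x * y / (2 * t)) = (\<Sum>k. u powr \<alpha> * ((u\<^sup>2) ^ k * rGamma (\<alpha> + 1 + real k) / fact k))"
    unfolding bessel_I_def u_def by (simp add: add_ac mult.assoc)
  also have "\<dots> = u powr \<alpha> * S" using sums_unique[OF sums_mult[OF S]] by simp
  finally have I: "bessel_I \<alpha> (x * y / (2 * t)) = u powr \<alpha> * S" .
  have p: "(x * y) powr (- \<alpha>) * u powr \<alpha> = (4 * t) powr (- \<alpha>)"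
  proof -
    have "u powr \<alpha> = (x * y) powr \<alpha> / (4 * t) powr \<alpha>"
      unfolding u_def using pos by (intro powr_divide)
    then show ?thesis using pos by (simp add: powr_minus divide_simps)
  qed
  define c where "c = (4 * t) powr (- \<alpha>) / (2 * t) * exp (- (x\<^sup>2 / (4 * t))) * exp (- (1 / (4 * t) * y\<^sup>2))"
  have e: "exp (- (x\<^sup>2 + y\<^sup>2) / (4 * t)) = exp (- (x\<^sup>2 / (4 * t))) * exp (- (1 / (4 * t) * y\<^sup>2))"
    by (simp add: exp_add[symmetric] diff_divide_distrib)
  have "bessel_kernel \<alpha> t x y = (1 / (2 * t)) * exp (- (x\<^sup>2 + y\<^sup>2) / (4 * t)) * ((x * y) powr (- \<alpha>) * u powr \<alpha>) * S"
    unfolding bessel_kernel_def I by (simp add: mult_ac)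
  also have "\<dots> = c * S" unfolding p e c_def by simp
  finally have K: "bessel_kernel \<alpha> t x y = c * S" .
  have "bessel_weight \<alpha> t x k * (y ^ (2 * k) * exp (- (1 / (4 * t) * y\<^sup>2)))
      = c * ((u\<^sup>2) ^ k * rGamma (\<alpha> + 1 + real k) / fact k)" for k
  proof -
    have "x\<^sup>2 / (16 * t\<^sup>2) * y\<^sup>2 = u\<^sup>2" by (simp add: u_def power2_eq_square)
    then have "(x\<^sup>2 / (16 * t\<^sup>2)) ^ k * y ^ (2 * k) = (u\<^sup>2) ^ k"
      by (simp only: power_mult power_mult_distrib[symmetric])
    then show ?thesis unfolding bessel_weight_def c_def by (simp add: mult_ac)
  qed
  then show ?thesis unfolding K using sums_mult[OF S, of c] by simp
qed

lemma ennreal_bessel_kernel: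
  assumes "-1 < \<alpha>" "0 < t" "0 < x" "0 < y"
  shows "ennreal (bessel_kernel \<alpha> t x y)
    = (\<Sum>k. ennreal (bessel_weight \<alpha> t x k) * ennreal (y ^ (2 * k) * exp (- (1 / (4 * t) * y\<^sup>2))))"
proof -
  have "(\<Sum>k. ennreal (bessel_weight \<alpha> t x k * (y ^ (2 * k) * exp (- (1 / (4 * t) * y\<^sup>2))))) = ennreal (bessel_kernel \<alpha> t x y)"
    using assms by (intro suminf_ennreal_eq bessel_kernel_sums) (auto simp: bessel_weight_nonneg)
  then show ?thesis using assms by (simp add: ennreal_mult bessel_weight_nonneg)
qed

lemma bessel_kernel_nonneg:
  assumes "-1 < \<alpha>" "0 < t" "0 < x" "0 < y"
  shows "0 \<le> bessel_kernel \<alpha> t x y"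
  by (rule sums_le[OF _ sums_zero bessel_kernel_sums[OF assms]])
    (use assms in \<open>auto simp: bessel_weight_nonneg\<close>)

lemma bessel_kernel_commute: "bessel_kernel \<alpha> t x y = bessel_kernel \<alpha> t y x"
  by (simp add: bessel_kernel_def mult.commute add.commute)

lemma bessel_kernel_measurable:
  "(\<lambda>p. bessel_kernel \<alpha> t (fst p) (snd p)) \<in> borel_measurable (bessel_measure \<alpha> \<Otimes>\<^sub>M bessel_measure \<alpha>)"
  unfolding bessel_kernel_def bessel_I_def by measurable

text \<open>The right side is the Poisson probability of k for the mean x^2 / (4t). Accordingly,
  under the kernel y^2 / (2t) follows a noncentral chi-square law with 2\<alpha> + 2 degrees of
  freedom.\<close>

lemma bessel_weight_Gamma:
  assumes "-1 < \<alpha>" "0 < t"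
  shows "bessel_weight \<alpha> t x k * (Gamma (\<alpha> + 1 + k) / (2 * (1 / (4 * t)) powr (\<alpha> + 1 + k)))
    = exp (- (x\<^sup>2 / (4 * t))) * (x\<^sup>2 / (4 * t)) ^ k / fact k"
proof -
  have G: "rGamma (\<alpha> + 1 + k) * Gamma (\<alpha> + 1 + k) = 1"
  proof -
    have "0 < \<alpha> + 1 + real k" using assms by linarith
    then have "Gamma (\<alpha> + 1 + real k) \<noteq> 0" using Gamma_real_pos[of "\<alpha> + 1 + real k"] by linarith
    then show ?thesis by (simp add: rGamma_inverse_Gamma)
  qed
  have w: "(1 / (4 * t)) powr (\<alpha> + 1 + k) = inverse ((4 * t) powr \<alpha> * (4 * t) * (4 * t) ^ k)"
    using assms by (simp add: powr_divide powr_add powr_realpow inverse_eq_divide)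
  have u: "(4 * t) powr (- \<alpha>) * (4 * t) powr \<alpha> = 1"
    using assms by (simp add: powr_minus)
  have "x\<^sup>2 / (16 * t\<^sup>2) * (4 * t) = x\<^sup>2 / (4 * t)" using assms by (simp add: power2_eq_square)
  then have x: "(x\<^sup>2 / (16 * t\<^sup>2)) ^ k * (4 * t) ^ k = (x\<^sup>2 / (4 * t)) ^ k"
    by (simp only: power_mult_distrib[symmetric])
  have "bessel_weight \<alpha> t x k * (Gamma (\<alpha> + 1 + k) / (2 * inverse ((4 * t) powr \<alpha> * (4 * t) * (4 * t) ^ k)))
    = ((4 * t) powr (- \<alpha>) * (4 * t) powr \<alpha>) * (rGamma (\<alpha> + 1 + k) * Gamma (\<alpha> + 1 + k))
      * exp (- (x\<^sup>2 / (4 * t))) * ((x\<^sup>2 / (16 * t\<^sup>2)) ^ k * (4 * t) ^ k) / fact k"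
    unfolding bessel_weight_def using assms by (simp add: divide_simps)
  then show ?thesis unfolding w u G x by simp
qed

text \<open>Monotone convergence reduces integrals against the kernel to Gaussian ones. It is used
  for g = 1 and for g(y) = (y^2 - x^2)^2.\<close>

lemma nn_integral_bessel_kernel:
  assumes \<alpha>: "-1 < \<alpha>" and pos: "0 < t" "0 < x" and [measurable]: "g \<in> borel_measurable borel"
  shows "(\<integral>\<^sup>+y. ennreal (bessel_kernel \<alpha> t x y) * g y \<partial>bessel_measure \<alpha>)
    = (\<Sum>k. ennreal (bessel_weight \<alpha> t x k)
        * (\<integral>\<^sup>+y. ennreal (y ^ (2 * k) * exp (- (1 / (4 * t) * y\<^sup>2))) * g y \<partial>bessel_measure \<alpha>))"
proof -
  have [measurable]: "g \<in> borel_measurable (bessel_measure \<alpha>)" by (rule measurable_bessel_borel) fact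
  have "(\<integral>\<^sup>+y. ennreal (bessel_kernel \<alpha> t x y) * g y \<partial>bessel_measure \<alpha>)
      = (\<integral>\<^sup>+y. (\<Sum>k. ennreal (bessel_weight \<alpha> t x k) * (ennreal (y ^ (2 * k) * exp (- (1 / (4 * t) * y\<^sup>2))) * g y)) \<partial>bessel_measure \<alpha>)"
  proof (intro nn_integral_cong)
    fix y assume "y \<in> space (bessel_measure \<alpha>)"
    then have y: "0 < y" by simp
    show "ennreal (bessel_kernel \<alpha> t x y) * g y
      = (\<Sum>k. ennreal (bessel_weight \<alpha> t x k) * (ennreal (y ^ (2 * k) * exp (- (1 / (4 * t) * y\<^sup>2))) * g y))"
      unfolding ennreal_bessel_kernel[OF \<alpha> pos y] mult.assoc[symmetric] by (rule ennreal_suminf_multc[symmetric])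
  qed
  also have "\<dots> = (\<Sum>k. \<integral>\<^sup>+y. ennreal (bessel_weight \<alpha> t x k) * (ennreal (y ^ (2 * k) * exp (- (1 / (4 * t) * y\<^sup>2))) * g y) \<partial>bessel_measure \<alpha>)"
    by (rule nn_integral_suminf) measurable
  also have "\<dots> = (\<Sum>k. ennreal (bessel_weight \<alpha> t x k)
        * (\<integral>\<^sup>+y. ennreal (y ^ (2 * k) * exp (- (1 / (4 * t) * y\<^sup>2))) * g y \<partial>bessel_measure \<alpha>))"
    by (intro arg_cong[where f = suminf] ext nn_integral_cmult) measurable
  finally show ?thesis .
qed

lemma bessel_kernel_stochastic:
  assumes \<alpha>: "-1 < \<alpha>" and pos: "0 < t" "0 < x"
  shows "(\<integral>\<^sup>+y. ennreal (bessel_kernel \<alpha> t x y) \<partial>bessel_measure \<alpha>) = 1"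
proof -
  have "(\<integral>\<^sup>+y. ennreal (bessel_kernel \<alpha> t x y) \<partial>bessel_measure \<alpha>)
      = (\<Sum>k. ennreal (bessel_weight \<alpha> t x k)
        * ennreal (Gamma (\<alpha> + 1 + k) / (2 * (1 / (4 * t)) powr (\<alpha> + 1 + k))))"
    using nn_integral_bessel_kernel[OF \<alpha> pos, of "\<lambda>_. 1"] nn_integral_bessel_gaussian[OF \<alpha>, of "1 / (4 * t)"] pos
    by simp
  also have "\<dots> = (\<Sum>k. ennreal (exp (- (x\<^sup>2 / (4 * t))) * (x\<^sup>2 / (4 * t)) ^ k / fact k))"
    by (simp only: bessel_weight_Gamma[OF \<alpha> pos(1)] ennreal_mult'[symmetric]
        bessel_weight_nonneg[OF \<alpha> pos(1)])
  also have "\<dots> = ennreal 1"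
    using pos by (intro suminf_ennreal_eq poisson_sums) auto
  finally show ?thesis by simp
qed

text \<open>Expanding the square produces a negative middle term, so the computation takes place in
  Bochner integrals and returns to \<open>ennreal\<close> at the end. Consecutive Gaussian moments
  have ratio 4t (\<alpha> + 1 + n) by the Gamma recurrence.\<close>

lemma bessel_gaussian_second_moment:
  assumes \<alpha>: "-1 < \<alpha>" and t: "0 < t"
  shows "(\<integral>\<^sup>+y. ennreal (y ^ (2 * k) * exp (- (1 / (4 * t) * y\<^sup>2))) * ennreal ((y\<^sup>2 - x\<^sup>2)\<^sup>2) \<partial>bessel_measure \<alpha>)
    = ennreal (Gamma (\<alpha> + 1 + k) / (2 * (1 / (4 * t)) powr (\<alpha> + 1 + k))
      * (16 * t\<^sup>2 * (\<alpha> + 1 + k) * (\<alpha> + 2 + k) - 8 * t * x\<^sup>2 * (\<alpha> + 1 + k) + x ^ 4))"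
proof -
  define w where "w = 1 / (4 * t)"
  have w: "0 < w" using t by (simp add: w_def)
  define I where "I n = Gamma (\<alpha> + 1 + real n) / (2 * w powr (\<alpha> + 1 + real n))" for n
  have Suc: "I (Suc n) = (\<alpha> + 1 + n) / w * I n" for n
  proof -
    have "\<alpha> + 1 + real n \<notin> \<int>\<^sub>\<le>\<^sub>0" using \<alpha> by (auto elim!: nonpos_Ints_cases)
    then have "Gamma (\<alpha> + 1 + real n + 1) = (\<alpha> + 1 + real n) * Gamma (\<alpha> + 1 + real n)"
      by (rule Gamma_plus1)
    moreover have "w powr (\<alpha> + 1 + real n + 1) = w * w powr (\<alpha> + 1 + real n)"
      using w by (simp add: powr_add power2_eq_square)
    moreover have "\<alpha> + 1 + real (Suc n) = \<alpha> + 1 + real n + 1" by simp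
    ultimately show ?thesis unfolding I_def by (simp only:) simp
  qed
  define f where "f n y = y ^ (2 * n) * exp (- (w * y\<^sup>2))" for n and y :: real
  have f: "has_bochner_integral (bessel_measure \<alpha>) (f n) (I n)" for n
    unfolding f_def[abs_def] I_def using bessel_gaussian_moment[OF \<alpha> w] .
  have "has_bochner_integral (bessel_measure \<alpha>) (\<lambda>y. f (Suc (Suc k)) y - 2 * x\<^sup>2 * f (Suc k) y + x ^ 4 * f k y)
      (I (Suc (Suc k)) - 2 * x\<^sup>2 * I (Suc k) + x ^ 4 * I k)"
    by (intro has_bochner_integral_add has_bochner_integral_diff has_bochner_integral_mult_right f)
  moreover have "(\<lambda>y. f (Suc (Suc k)) y - 2 * x\<^sup>2 * f (Suc k) y + x ^ 4 * f k y)
      = (\<lambda>y. f k y * (y\<^sup>2 - x\<^sup>2)\<^sup>2)"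
    by (auto simp: f_def power2_eq_square power4_eq_xxxx algebra_simps)
  moreover have "I (Suc (Suc k)) - 2 * x\<^sup>2 * I (Suc k) + x ^ 4 * I k
      = I k * (16 * t\<^sup>2 * (\<alpha> + 1 + k) * (\<alpha> + 2 + k) - 8 * t * x\<^sup>2 * (\<alpha> + 1 + k) + x ^ 4)"
    unfolding Suc by (simp add: w_def power2_eq_square power4_eq_xxxx algebra_simps)
  ultimately have J: "has_bochner_integral (bessel_measure \<alpha>) (\<lambda>y. f k y * (y\<^sup>2 - x\<^sup>2)\<^sup>2)
      (I k * (16 * t\<^sup>2 * (\<alpha> + 1 + k) * (\<alpha> + 2 + k) - 8 * t * x\<^sup>2 * (\<alpha> + 1 + k) + x ^ 4))"
    by simp
  have "f k y * (y\<^sup>2 - x\<^sup>2)\<^sup>2 \<ge> 0" for y by (simp add: f_def)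
  then have "(\<integral>\<^sup>+y. ennreal (f k y * (y\<^sup>2 - x\<^sup>2)\<^sup>2) \<partial>bessel_measure \<alpha>)
      = ennreal (I k * (16 * t\<^sup>2 * (\<alpha> + 1 + k) * (\<alpha> + 2 + k) - 8 * t * x\<^sup>2 * (\<alpha> + 1 + k) + x ^ 4))"
    using J by (subst nn_integral_eq_integral) (auto simp: has_bochner_integral_iff)
  then show ?thesis by (simp add: f_def I_def w_def ennreal_mult)
qed

lemma bessel_kernel_second_moment:
  assumes \<alpha>: "-1 < \<alpha>" and pos: "0 < t" "0 < x"
  shows "(\<integral>\<^sup>+y. ennreal (bessel_kernel \<alpha> t x y) * ennreal ((y\<^sup>2 - x\<^sup>2)\<^sup>2) \<partial>bessel_measure \<alpha>)
    = ennreal (8 * t * x\<^sup>2 + 16 * t\<^sup>2 * (\<alpha> + 1) * (\<alpha> + 2))"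
proof -
  define A where "A = x\<^sup>2 / (4 * t)"
  define p where "p k = exp (- A) * A ^ k / fact k" for k
  have x2: "x\<^sup>2 = 4 * t * A" using pos by (simp add: A_def)
  have x4: "x ^ 4 = 16 * t\<^sup>2 * A\<^sup>2" using arg_cong[OF x2, of "\<lambda>z. z\<^sup>2"] by (simp add: power_mult_distrib)
  have p: "0 \<le> p k" for k using pos by (simp add: p_def A_def)
  define q where "q k = 16 * t\<^sup>2 * (\<alpha> + 1 + k) * (\<alpha> + 2 + k) - 8 * t * x\<^sup>2 * (\<alpha> + 1 + k) + x ^ 4" for k
  \<comment> \<open>For y^2 / (4t) with a Gamma law of shape \<alpha> + 1 + k, this is squared bias
    plus variance around A, scaled by (4t)^2. In this form it is visibly nonnegative.\<close>
  have q_eq: "q k = 16 * t\<^sup>2 * ((\<alpha> + 1 + k - A)\<^sup>2 + (\<alpha> + 1 + k))" for k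
    unfolding q_def x2 x4 by (simp add: power2_eq_square algebra_simps)
  have q: "0 \<le> q (real k)" for k unfolding q_eq using \<alpha> by simp
  have "(\<integral>\<^sup>+y. ennreal (bessel_kernel \<alpha> t x y) * ennreal ((y\<^sup>2 - x\<^sup>2)\<^sup>2) \<partial>bessel_measure \<alpha>)
      = (\<Sum>k. ennreal (bessel_weight \<alpha> t x k) * ennreal (Gamma (\<alpha> + 1 + k) / (2 * (1 / (4 * t)) powr (\<alpha> + 1 + k)) * q (real k)))"
    using nn_integral_bessel_kernel[OF \<alpha> pos, of "\<lambda>y. ennreal ((y\<^sup>2 - x\<^sup>2)\<^sup>2)"]
    by (simp only: bessel_gaussian_second_moment[OF \<alpha> pos(1)] q_def) simp
  also have "\<dots> = (\<Sum>k. ennreal (p k * q (real k)))"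
    by (simp only: ennreal_mult'[symmetric] bessel_weight_nonneg[OF \<alpha> pos(1)]
        mult.assoc[symmetric, of "bessel_weight _ _ _ _"] bessel_weight_Gamma[OF \<alpha> pos(1)] p_def A_def)
  also have "\<dots> = ennreal (8 * t * x\<^sup>2 + 16 * t\<^sup>2 * (\<alpha> + 1) * (\<alpha> + 2))"
  proof (rule suminf_ennreal_eq)
    \<comment> \<open>The quadratic in k is written in the basis k (k - 1), k, 1, whose Poisson
      means are A^2, A and 1.\<close>
    have "(\<lambda>k. 16 * t\<^sup>2 * (real k * (real k - 1) * p k + (2 * \<alpha> + 4 - 2 * A) * (real k * p k)
        + ((\<alpha> + 1) * (\<alpha> + 2) - 2 * A * (\<alpha> + 1) + A\<^sup>2) * p k))
      sums (16 * t\<^sup>2 * (A\<^sup>2 + (2 * \<alpha> + 4 - 2 * A) * A + ((\<alpha> + 1) * (\<alpha> + 2) - 2 * A * (\<alpha> + 1) + A\<^sup>2) * 1))"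
      unfolding p_def by (intro sums_mult sums_add poisson_sums)
    moreover have "16 * t\<^sup>2 * (real k * (real k - 1) * p k + (2 * \<alpha> + 4 - 2 * A) * (real k * p k)
        + ((\<alpha> + 1) * (\<alpha> + 2) - 2 * A * (\<alpha> + 1) + A\<^sup>2) * p k) = p k * q (real k)" for k
      unfolding q_eq by (simp add: power2_eq_square algebra_simps)
    moreover have "16 * t\<^sup>2 * (A\<^sup>2 + (2 * \<alpha> + 4 - 2 * A) * A + ((\<alpha> + 1) * (\<alpha> + 2) - 2 * A * (\<alpha> + 1) + A\<^sup>2) * 1)
      = 8 * t * x\<^sup>2 + 16 * t\<^sup>2 * (\<alpha> + 1) * (\<alpha> + 2)"
      unfolding x2 by (simp add: power2_eq_square algebra_simps)
    ultimately show "(\<lambda>k. p k * q (real k)) sums (8 * t * x\<^sup>2 + 16 * t\<^sup>2 * (\<alpha> + 1) * (\<alpha> + 2))"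
      by simp
  qed (use p q in simp)
  finally show ?thesis .
qed

section \<open>The Chapman-Kolmogorov identity for the Bessel kernel\<close>

lemma bessel_weight_convolution:
  fixes j k :: nat
  assumes \<alpha>: "-1 < \<alpha>" and st: "0 < s" "0 < t"
  defines "w \<equiv> 1 / (4 * s) + 1 / (4 * t)"
  shows "bessel_weight \<alpha> s x j * bessel_weight \<alpha> t y k
      * (Gamma (\<alpha> + 1 + (j + k)) / (2 * w powr (\<alpha> + 1 + (j + k))))
    = (4 * (s + t)) powr (- \<alpha>) / (2 * (s + t)) * exp (- (x\<^sup>2 / (4 * s)) - y\<^sup>2 / (4 * t))
      * ((x\<^sup>2 / (16 * s\<^sup>2 * w)) ^ j * (y\<^sup>2 / (16 * t\<^sup>2 * w)) ^ k
        * (Gamma (\<alpha> + 1 + j + k) * rGamma (\<alpha> + 1 + j) * rGamma (\<alpha> + 1 + k) / (fact j * fact k)))"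
proof -
  define u v q where "u = (4 * s) powr \<alpha>" and "v = (4 * t) powr \<alpha>" and "q = (4 * (s + t)) powr \<alpha>"
  have nz: "u \<noteq> 0" "v \<noteq> 0" "q \<noteq> 0" using st by (auto simp: u_def v_def q_def)
  have w: "0 < w" using st by (simp add: w_def add_pos_pos)
  \<comment> \<open>\<open>w\<close> is the rate of the product of the two Gaussians in the
    intermediate point. This factorisation lets the prefactors for \<open>s\<close> and
    \<open>t\<close> combine into the prefactor for \<open>s + t\<close>.\<close>
  have w_eq: "w = (4 * (s + t)) / (4 * s * (4 * t))" using st by (simp add: w_def field_simps)
  have "w powr \<alpha> = q / (u * v)"
    unfolding w_eq q_def u_def v_def powr_mult[of "4 * s" "4 * t" \<alpha>, symmetric]
    using st by (intro powr_divide)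
  then have wp: "w powr (\<alpha> + 1 + (j + k)) = q / (u * v) * w * w ^ j * w ^ k"
    using w by (simp add: powr_add powr_realpow power_add)
  have c: "1 / u / (2 * s) * (1 / v / (2 * t)) / (2 * (q / (u * v) * w)) = 1 / q / (2 * (s + t))"
  proof -
    have "1 / u / (2 * s) * (1 / v / (2 * t)) / (2 * (q / (u * v) * ((4 * r) / (4 * s * (4 * t))))) = 1 / q / (2 * r)"
      if "r \<noteq> 0" for r using st nz that by (simp add: divide_simps)
    moreover have "s + t \<noteq> 0" using st by simp
    ultimately show ?thesis unfolding w_eq by blast
  qed
  have "bessel_weight \<alpha> s x j * bessel_weight \<alpha> t y k * (Gamma (\<alpha> + 1 + (j + k)) / (2 * w powr (\<alpha> + 1 + (j + k))))
    = (1 / u / (2 * s) * (1 / v / (2 * t)) / (2 * (q / (u * v) * w)))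
      * (exp (- (x\<^sup>2 / (4 * s))) * exp (- (y\<^sup>2 / (4 * t))))
      * (((x\<^sup>2 / (16 * s\<^sup>2)) ^ j / w ^ j) * ((y\<^sup>2 / (16 * t\<^sup>2)) ^ k / w ^ k)
        * (Gamma (\<alpha> + 1 + j + k) * rGamma (\<alpha> + 1 + j) * rGamma (\<alpha> + 1 + k) / (fact j * fact k)))"
    unfolding wp bessel_weight_def powr_minus u_def[symmetric] v_def[symmetric]
    using st nz w by (simp add: divide_simps add.assoc) (simp add: mult_ac)?
  then show ?thesis
    unfolding c powr_minus q_def[symmetric] power_divide[symmetric] exp_add[symmetric]
    by (simp add: inverse_eq_divide)
qed

lemma bessel_chapman_kolmogorov:
  assumes \<alpha>: "-1 < \<alpha>" and st: "0 < s" "0 < t" and xy: "0 < x" "0 < y"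
  shows "(\<integral>\<^sup>+z. ennreal (bessel_kernel \<alpha> s x z) * ennreal (bessel_kernel \<alpha> t z y) \<partial>bessel_measure \<alpha>)
    = ennreal (bessel_kernel \<alpha> (s + t) x y)"
proof -
  define w where "w = 1 / (4 * s) + 1 / (4 * t)"
  have w: "0 < w" using st by (simp add: w_def add_pos_pos)
  define C where "C = (4 * (s + t)) powr (- \<alpha>) / (2 * (s + t)) * exp (- (x\<^sup>2 / (4 * s)) - y\<^sup>2 / (4 * t))"
  have C: "0 \<le> C" using st by (simp add: C_def)
  \<comment> \<open>The ratios of the two weight series, each divided by the factor \<open>w\<close>
    that integrating another power of z^2 brings into the denominator.\<close>
  define a b where "a = x\<^sup>2 / (16 * s\<^sup>2 * w)" and "b = y\<^sup>2 / (16 * t\<^sup>2 * w)"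
  have ab: "0 \<le> a" "0 \<le> b" using w by (auto simp: a_def b_def)
  define V where "V j k = a ^ j * b ^ k * (Gamma (\<alpha> + 1 + j + k) * rGamma (\<alpha> + 1 + j) * rGamma (\<alpha> + 1 + k) / (fact j * fact k))"
    for j k :: nat
  let ?W = "\<lambda>j k. ennreal (bessel_weight \<alpha> s x j * bessel_weight \<alpha> t y k)"
  let ?g = "\<lambda>n z. ennreal (z ^ (2 * n) * exp (- (w * z\<^sup>2)))"
  have "(\<integral>\<^sup>+z. ennreal (bessel_kernel \<alpha> s x z) * ennreal (bessel_kernel \<alpha> t z y) \<partial>bessel_measure \<alpha>)
      = (\<integral>\<^sup>+z. (\<Sum>j. \<Sum>k. ?W j k * ?g (j + k) z) \<partial>bessel_measure \<alpha>)"
  proof (intro nn_integral_cong)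
    fix z assume "z \<in> space (bessel_measure \<alpha>)"
    then have z: "0 < z" by simp
    have "ennreal (bessel_weight \<alpha> s x j) * ennreal (z ^ (2 * j) * exp (- (1 / (4 * s) * z\<^sup>2)))
        * (ennreal (bessel_weight \<alpha> t y k) * ennreal (z ^ (2 * k) * exp (- (1 / (4 * t) * z\<^sup>2))))
      = ?W j k * ?g (j + k) z" for j k
    proof -
      have "z ^ (2 * j) * exp (- (1 / (4 * s) * z\<^sup>2)) * (z ^ (2 * k) * exp (- (1 / (4 * t) * z\<^sup>2)))
          = z ^ (2 * (j + k)) * exp (- (w * z\<^sup>2))"
        by (simp add: w_def power_add algebra_simps exp_add[symmetric] exp_diff[symmetric])
      moreover have "ennreal A * ennreal P * (ennreal B * ennreal Q) = ennreal (A * B) * ennreal (P * Q)"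
        if "0 \<le> A" "0 \<le> B" "0 \<le> P" "0 \<le> Q" for A B P Q
        using that by (simp add: ennreal_mult mult_ac)
      ultimately show ?thesis
        using st by (simp add: bessel_weight_nonneg[OF \<alpha>])
    qed
    \<comment> \<open>Symmetry lets the second kernel be expanded in z as well, with weights
      depending on y, so that both factors are series in the variable of integration.\<close>
    then show "ennreal (bessel_kernel \<alpha> s x z) * ennreal (bessel_kernel \<alpha> t z y) = (\<Sum>j. \<Sum>k. ?W j k * ?g (j + k) z)"
      unfolding bessel_kernel_commute[of \<alpha> t z y] ennreal_bessel_kernel[OF \<alpha> st(1) xy(1) z]
        ennreal_bessel_kernel[OF \<alpha> st(2) xy(2) z]
      by (subst suminf_ennreal_commute)
        (simp only: ennreal_suminf_cmult[symmetric] ennreal_suminf_multc[symmetric])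
  qed
  also have "\<dots> = (\<Sum>j. \<integral>\<^sup>+z. (\<Sum>k. ?W j k * ?g (j + k) z) \<partial>bessel_measure \<alpha>)"
    by (rule nn_integral_suminf) measurable
  also have "\<dots> = (\<Sum>j. \<Sum>k. \<integral>\<^sup>+z. ?W j k * ?g (j + k) z \<partial>bessel_measure \<alpha>)"
    by (intro arg_cong[where f = suminf] ext nn_integral_suminf) measurable
  also have "\<dots> = (\<Sum>j. \<Sum>k. ennreal C * ennreal (V j k))"
  proof (intro arg_cong[where f = suminf] ext)
    fix j k
    have "(\<integral>\<^sup>+z. ?W j k * ?g (j + k) z \<partial>bessel_measure \<alpha>) = ?W j k * (\<integral>\<^sup>+z. ?g (j + k) z \<partial>bessel_measure \<alpha>)"
      by (rule nn_integral_cmult) measurable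
    also have "\<dots> = ennreal (bessel_weight \<alpha> s x j * bessel_weight \<alpha> t y k
        * (Gamma (\<alpha> + 1 + real (j + k)) / (2 * w powr (\<alpha> + 1 + real (j + k)))))"
      unfolding nn_integral_bessel_gaussian[OF \<alpha> w]
      by (rule ennreal_mult'[symmetric]) (simp add: bessel_weight_nonneg \<alpha> st)
    also have "\<dots> = ennreal (C * V j k)"
      using bessel_weight_convolution[OF \<alpha> st, of x j y k]
      by (simp add: w_def C_def V_def a_def b_def)
    also have "\<dots> = ennreal C * ennreal (V j k)"
      using C by (rule ennreal_mult')
    finally show "(\<integral>\<^sup>+z. ?W j k * ?g (j + k) z \<partial>bessel_measure \<alpha>) = ennreal C * ennreal (V j k)" .
  qed
  also have "\<dots> = ennreal C * (\<Sum>j. \<Sum>k. ennreal (V j k))"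
    by simp
  also have "\<dots> = ennreal C * (\<Sum>n. ennreal (exp (a + b) * ((a * b) ^ n * rGamma (\<alpha> + 1 + n) / fact n)))"
    unfolding V_def using \<alpha> ab by (subst bessel_double_series) simp_all
  also have "\<dots> = (\<Sum>n. ennreal (C * (exp (a + b) * ((a * b) ^ n * rGamma (\<alpha> + 1 + n) / fact n))))"
    by (simp only: ennreal_suminf_cmult[symmetric] ennreal_mult'[OF C, symmetric])
  also have "\<dots> = (\<Sum>n. ennreal (bessel_weight \<alpha> (s + t) x n)
      * ennreal (y ^ (2 * n) * exp (- (1 / (4 * (s + t)) * y\<^sup>2))))"
  proof (intro arg_cong[where f = suminf] ext)
    fix n
    have w_eq: "w = (s + t) / (4 * s * t)" using st by (simp add: w_def field_simps)
    have sum: "s + t \<noteq> 0" "s \<noteq> 0" "t \<noteq> 0" using st by auto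
    have "a = x\<^sup>2 * t / (4 * s * (s + t))" "b = y\<^sup>2 * s / (4 * t * (s + t))"
      using sum by (simp_all add: a_def b_def w_eq power2_eq_square divide_simps)
    \<comment> \<open>Partial fractions split a and b so that exp(a + b) cancels the Gaussian
      factors for times s and t and leaves those for s + t.\<close>
    moreover have frac: "z * r / (4 * q * (q + r)) = z / (4 * q) - z / (4 * (q + r))"
      if "q + r \<noteq> 0" "q \<noteq> 0" for q r z :: real
      using that by (simp add: divide_simps) (simp add: algebra_simps)
    ultimately have "a = x\<^sup>2 / (4 * s) - x\<^sup>2 / (4 * (s + t))" "b = y\<^sup>2 / (4 * t) - y\<^sup>2 / (4 * (s + t))"
      using sum frac[of s t "x\<^sup>2"] frac[of t s "y\<^sup>2"] by (simp_all add: add.commute)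
    then have "- (x\<^sup>2 / (4 * s)) - y\<^sup>2 / (4 * t) + (a + b) = - (x\<^sup>2 / (4 * (s + t))) + - (1 / (4 * (s + t)) * y\<^sup>2)"
      by simp
    then have e: "exp (- (x\<^sup>2 / (4 * s)) - y\<^sup>2 / (4 * t)) * exp (a + b)
        = exp (- (x\<^sup>2 / (4 * (s + t)))) * exp (- (1 / (4 * (s + t)) * y\<^sup>2))"
      by (simp only: exp_add[symmetric])
    have "a * b = x\<^sup>2 / (16 * (s + t)\<^sup>2) * y\<^sup>2"
      using sum by (simp add: a_def b_def w_eq power2_eq_square divide_simps) (simp add: algebra_simps)
    then have p: "(a * b) ^ n = (x\<^sup>2 / (16 * (s + t)\<^sup>2)) ^ n * y ^ (2 * n)"
      by (simp only: power_mult_distrib power_mult)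
    have "C * (exp (a + b) * ((a * b) ^ n * rGamma (\<alpha> + 1 + n) / fact n))
      = (4 * (s + t)) powr (- \<alpha>) / (2 * (s + t)) * (exp (- (x\<^sup>2 / (4 * s)) - y\<^sup>2 / (4 * t)) * exp (a + b))
        * ((a * b) ^ n * rGamma (\<alpha> + 1 + n) / fact n)"
      unfolding C_def by (simp only: mult.assoc)
    also have "\<dots> = bessel_weight \<alpha> (s + t) x n * (y ^ (2 * n) * exp (- (1 / (4 * (s + t)) * y\<^sup>2)))"
      unfolding e p bessel_weight_def by simp
    finally show "ennreal (C * (exp (a + b) * ((a * b) ^ n * rGamma (\<alpha> + 1 + n) / fact n)))
      = ennreal (bessel_weight \<alpha> (s + t) x n) * ennreal (y ^ (2 * n) * exp (- (1 / (4 * (s + t)) * y\<^sup>2)))"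
      using \<alpha> st by (simp add: ennreal_mult' bessel_weight_nonneg)
  qed
  also have "\<dots> = ennreal (bessel_kernel \<alpha> (s + t) x y)"
    using \<alpha> st xy by (intro ennreal_bessel_kernel[symmetric]) auto
  finally show ?thesis .
qed

section \<open>Bessel kernels as a Markov semigroup, and their vanishing energy\<close>

lemma symmetric_markov_kernel_bessel:
  assumes "-1 < \<alpha>" "0 < t"
  shows "symmetric_markov_kernel (bessel_measure \<alpha>) (bessel_kernel \<alpha> t)"
  using assms
  by (intro symmetric_markov_kernel.intro sigma_finite_bessel_measure symmetric_markov_kernel_axioms.intro)
    (simp_all add: bessel_kernel_measurable bessel_kernel_nonneg bessel_kernel_stochastic
      bessel_kernel_commute[of \<alpha> t])

lemma symmetric_markov_kernel_semigroup_bessel: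
  assumes "-1 < \<alpha>"
  shows "symmetric_markov_kernel_semigroup (bessel_measure \<alpha>) (bessel_kernel \<alpha>)"
  using assms
  by (intro symmetric_markov_kernel_semigroup.intro sigma_finite_bessel_measure
      symmetric_markov_kernel_semigroup_axioms.intro)
    (simp_all add: symmetric_markov_kernel_bessel bessel_chapman_kolmogorov)

text \<open>On the interval the constant 1 is at most exp(R^2) exp(-y^2), whose integral is a known
  Gamma value.\<close>

lemma emeasure_bessel_interval_finite:
  assumes "-1 < \<alpha>"
  shows "emeasure (bessel_measure \<alpha>) {0<..R} < \<infinity>"
proof -
  have "{0<..R} \<in> sets (bessel_measure \<alpha>)"
    by (auto simp: sets_bessel_measure sets_restrict_space_iff)
  then have "emeasure (bessel_measure \<alpha>) {0<..R} = (\<integral>\<^sup>+y. indicator {0<..R} y \<partial>bessel_measure \<alpha>)"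
    by simp
  also have "\<dots> \<le> (\<integral>\<^sup>+y. ennreal (exp (R\<^sup>2)) * ennreal (y ^ (2 * 0) * exp (- (1 * y\<^sup>2))) \<partial>bessel_measure \<alpha>)"
  proof (intro nn_integral_mono)
    fix y :: real
    have "1 \<le> exp (R\<^sup>2) * exp (- y\<^sup>2)" if "0 < y" "y \<le> R"
      using that by (simp add: exp_add[symmetric] power_mono)
    then show "indicator {0<..R} y \<le> ennreal (exp (R\<^sup>2)) * ennreal (y ^ (2 * 0) * exp (- (1 * y\<^sup>2)))"
      by (auto simp: ennreal_mult[symmetric] split: split_indicator)
  qed
  also have "\<dots> = ennreal (exp (R\<^sup>2)) * (\<integral>\<^sup>+y. ennreal (y ^ (2 * 0) * exp (- (1 * y\<^sup>2))) \<partial>bessel_measure \<alpha>)"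
    by (rule nn_integral_cmult) measurable
  also have "\<dots> < \<infinity>"
    unfolding nn_integral_bessel_gaussian[OF assms zero_less_one] by (simp add: ennreal_mult_less_top)
  finally show ?thesis .
qed

text \<open>The increment of f vanishes unless x or y lies in (0, R]. By symmetry of the kernel both
  cases contribute equally, whence the factor 2; with x confined to (0, R] the inner integral is the
  second moment, which is largest at x = R.\<close>

lemma bessel_energy_bound:
  fixes f :: "real \<Rightarrow> real"
  assumes \<alpha>: "-1 < \<alpha>" and t: "0 < t" and [measurable]: "f \<in> borel_measurable (bessel_measure \<alpha>)"
    and lip: "\<And>x y. 0 < x \<Longrightarrow> 0 < y \<Longrightarrow> \<bar>f x - f y\<bar> \<le> m * \<bar>y\<^sup>2 - x\<^sup>2\<bar>"
    and supp: "\<And>x. R < x \<Longrightarrow> f x = 0"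
  shows "symmetric_markov_kernel.kernel_energy (bessel_measure \<alpha>) (bessel_kernel \<alpha> t) f
    \<le> 2 * (ennreal (m\<^sup>2 * (8 * t * R\<^sup>2 + 16 * t\<^sup>2 * (\<alpha> + 1) * (\<alpha> + 2))) * emeasure (bessel_measure \<alpha>) {0<..R})"
proof -
  let ?M = "bessel_measure \<alpha>" and ?K = "{0<..R}"
  interpret symmetric_markov_kernel ?M "bessel_kernel \<alpha> t"
    by (rule symmetric_markov_kernel_bessel[OF \<alpha> t])
  have [measurable]: "?K \<in> sets ?M" by (auto simp: sets_bessel_measure sets_restrict_space_iff)
  let ?D = "\<lambda>x y. ennreal (bessel_kernel \<alpha> t x y) * ennreal ((y\<^sup>2 - x\<^sup>2)\<^sup>2)"
  have "kernel_energy f \<le> (\<integral>\<^sup>+x. \<integral>\<^sup>+y. ennreal (m\<^sup>2) * indicator ?K x * ?D x y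
      + ennreal (m\<^sup>2) * indicator ?K y * ?D x y \<partial>?M \<partial>?M)"
    unfolding kernel_energy_def
  proof (intro nn_integral_mono)
    fix x y assume "x \<in> space ?M" "y \<in> space ?M"
    then have xy: "0 < x" "0 < y" by auto
    have sq: "(f x - f y)\<^sup>2 \<le> m\<^sup>2 * (y\<^sup>2 - x\<^sup>2)\<^sup>2"
      using power_mono[OF lip[OF xy] abs_ge_zero, of 2] by (simp add: power_mult_distrib)
    have "ennreal ((f x - f y)\<^sup>2) \<le> ennreal (m\<^sup>2) * ennreal ((y\<^sup>2 - x\<^sup>2)\<^sup>2) * (indicator ?K x + indicator ?K y)"
    proof (cases "R < x \<and> R < y")
      case True
      then show ?thesis by (simp add: supp)
    next
      case False
      then have "1 \<le> (indicator ?K x + indicator ?K y :: ennreal)"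
        using xy by (auto split: split_indicator)
      from mult_left_mono[OF this, of "ennreal (m\<^sup>2) * ennreal ((y\<^sup>2 - x\<^sup>2)\<^sup>2)"]
      have "ennreal (m\<^sup>2) * ennreal ((y\<^sup>2 - x\<^sup>2)\<^sup>2)
        \<le> ennreal (m\<^sup>2) * ennreal ((y\<^sup>2 - x\<^sup>2)\<^sup>2) * (indicator ?K x + indicator ?K y)" by simp
      moreover have "ennreal ((f x - f y)\<^sup>2) \<le> ennreal (m\<^sup>2) * ennreal ((y\<^sup>2 - x\<^sup>2)\<^sup>2)"
        using ennreal_leI[OF sq] by (simp add: ennreal_mult)
      ultimately show ?thesis by (rule order_trans[rotated])
    qed
    then have "ennreal (bessel_kernel \<alpha> t x y) * ennreal ((f x - f y)\<^sup>2) \<le> ennreal (bessel_kernel \<alpha> t x y)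
        * (ennreal (m\<^sup>2) * ennreal ((y\<^sup>2 - x\<^sup>2)\<^sup>2) * (indicator ?K x + indicator ?K y))"
      by (rule mult_left_mono) simp
    also have "\<dots> = ennreal (m\<^sup>2) * indicator ?K x * ?D x y + ennreal (m\<^sup>2) * indicator ?K y * ?D x y"
      by (simp only: distrib_left distrib_right mult_ac)
    finally show "ennreal (bessel_kernel \<alpha> t x y) * ennreal ((f x - f y)\<^sup>2)
      \<le> ennreal (m\<^sup>2) * indicator ?K x * ?D x y + ennreal (m\<^sup>2) * indicator ?K y * ?D x y" .
  qed
  also have "\<dots> = (\<integral>\<^sup>+x. \<integral>\<^sup>+y. ennreal (m\<^sup>2) * indicator ?K x * ?D x y \<partial>?M \<partial>?M)
      + (\<integral>\<^sup>+x. \<integral>\<^sup>+y. ennreal (m\<^sup>2) * indicator ?K y * ?D x y \<partial>?M \<partial>?M)"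
    by (rule nn_integral_pair_add) measurable
  also have "(\<integral>\<^sup>+x. \<integral>\<^sup>+y. ennreal (m\<^sup>2) * indicator ?K y * ?D x y \<partial>?M \<partial>?M)
      = (\<integral>\<^sup>+y. \<integral>\<^sup>+x. ennreal (m\<^sup>2) * indicator ?K y * ?D x y \<partial>?M \<partial>?M)"
    by (rule pair.Fubini'[symmetric]) measurable
  also have "\<dots> = (\<integral>\<^sup>+x. \<integral>\<^sup>+y. ennreal (m\<^sup>2) * indicator ?K x * ?D x y \<partial>?M \<partial>?M)"
    by (simp add: bessel_kernel_commute[of \<alpha> t] power2_commute)
  also have "(\<integral>\<^sup>+x. \<integral>\<^sup>+y. ennreal (m\<^sup>2) * indicator ?K x * ?D x y \<partial>?M \<partial>?M)
      \<le> (\<integral>\<^sup>+x. ennreal (m\<^sup>2 * (8 * t * R\<^sup>2 + 16 * t\<^sup>2 * (\<alpha> + 1) * (\<alpha> + 2))) * indicator ?K x \<partial>?M)"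
  proof (intro nn_integral_mono)
    fix x assume x: "x \<in> space ?M"
    then have x0: "0 < x" by simp
    have "(\<integral>\<^sup>+y. ennreal (m\<^sup>2) * indicator ?K x * ?D x y \<partial>?M)
        = ennreal (m\<^sup>2) * indicator ?K x * (\<integral>\<^sup>+y. ?D x y \<partial>?M)"
      using x by (intro nn_integral_cmult) measurable
    also have "\<dots> = ennreal (m\<^sup>2) * indicator ?K x * ennreal (8 * t * x\<^sup>2 + 16 * t\<^sup>2 * (\<alpha> + 1) * (\<alpha> + 2))"
      unfolding bessel_kernel_second_moment[OF \<alpha> t x0] ..
    also have "\<dots> \<le> ennreal (m\<^sup>2 * (8 * t * R\<^sup>2 + 16 * t\<^sup>2 * (\<alpha> + 1) * (\<alpha> + 2))) * indicator ?K x"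
    proof (cases "x \<in> ?K")
      case True
      then have "m\<^sup>2 * (8 * t * x\<^sup>2 + 16 * t\<^sup>2 * (\<alpha> + 1) * (\<alpha> + 2))
          \<le> m\<^sup>2 * (8 * t * R\<^sup>2 + 16 * t\<^sup>2 * (\<alpha> + 1) * (\<alpha> + 2))"
        using t by (intro mult_left_mono add_right_mono power_mono) auto
      then show ?thesis using True
        by (simp add: ennreal_mult'[symmetric] ennreal_leI)
    qed simp
    finally show "(\<integral>\<^sup>+y. ennreal (m\<^sup>2) * indicator ?K x * ?D x y \<partial>?M)
      \<le> ennreal (m\<^sup>2 * (8 * t * R\<^sup>2 + 16 * t\<^sup>2 * (\<alpha> + 1) * (\<alpha> + 2))) * indicator ?K x" .
  qed
  also have "\<dots> = ennreal (m\<^sup>2 * (8 * t * R\<^sup>2 + 16 * t\<^sup>2 * (\<alpha> + 1) * (\<alpha> + 2))) * emeasure ?M ?K"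
    by (simp add: nn_integral_cmult)
  finally show ?thesis by (simp add: mult_2 add_mono)
qed

lemma bessel_energy_vanishes_Lipschitz:
  fixes f :: "real \<Rightarrow> real"
  assumes \<alpha>: "-1 < \<alpha>" and meas: "f \<in> borel_measurable (bessel_measure \<alpha>)"
    and lip: "\<And>x y. 0 < x \<Longrightarrow> 0 < y \<Longrightarrow> \<bar>f x - f y\<bar> \<le> m * \<bar>y\<^sup>2 - x\<^sup>2\<bar>"
    and supp: "\<And>x. R < x \<Longrightarrow> f x = 0"
  shows "symmetric_markov_kernel_semigroup.energy_vanishes (bessel_measure \<alpha>) (bessel_kernel \<alpha>) f"
proof -
  interpret symmetric_markov_kernel_semigroup "bessel_measure \<alpha>" "bessel_kernel \<alpha>"
    by (rule symmetric_markov_kernel_semigroup_bessel[OF \<alpha>])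
  let ?\<mu> = "measure (bessel_measure \<alpha>) {0<..R}"
  \<comment> \<open>Finiteness of the measure makes the product in the bound continuous at t =
    0.\<close>
  have \<mu>: "emeasure (bessel_measure \<alpha>) {0<..R} = ennreal ?\<mu>"
    using emeasure_bessel_interval_finite[OF \<alpha>, of R] by (intro emeasure_eq_ennreal_measure) auto
  let ?B = "\<lambda>t. 2 * (ennreal (m\<^sup>2 * (8 * t * R\<^sup>2 + 16 * t\<^sup>2 * (\<alpha> + 1) * (\<alpha> + 2))) * ennreal ?\<mu>)"
  show ?thesis unfolding energy_vanishes_def
  proof (rule tendsto_sandwich[OF _ _ tendsto_const])
    show "\<forall>\<^sub>F t in at_right 0. energy_at t f \<le> ?B t"
      using eventually_pos
    proof eventually_elim
      case (elim t)
      show ?case unfolding \<mu>[symmetric] by (rule bessel_energy_bound[OF \<alpha> elim meas lip supp])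
    qed
    have "(?B \<longlongrightarrow> 2 * (ennreal (m\<^sup>2 * (8 * 0 * R\<^sup>2 + 16 * 0\<^sup>2 * (\<alpha> + 1) * (\<alpha> + 2))) * ennreal ?\<mu>)) (at_right 0)"
      by (intro ennreal_tendsto_cmult tendsto_mult_ennreal tendsto_intros) auto
    then show "(?B \<longlongrightarrow> 0) (at_right 0)" by simp
  qed simp
qed

lemma bessel_energy_vanishes_interval:
  assumes \<alpha>: "-1 < \<alpha>" and a: "0 < a"
  shows "symmetric_markov_kernel_semigroup.energy_vanishes (bessel_measure \<alpha>) (bessel_kernel \<alpha>) (indicator {0<..a})"
proof -
  interpret symmetric_markov_kernel_semigroup "bessel_measure \<alpha>" "bessel_kernel \<alpha>"
    by (rule symmetric_markov_kernel_semigroup_bessel[OF \<alpha>])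
  \<comment> \<open>A ramp that is 1 on (0, a] and falls with slope m + 1 in the variable x^2,
    reaching 0 at x^2 = a^2 + 1 / (m + 1).\<close>
  define \<phi> :: "nat \<Rightarrow> real \<Rightarrow> real" where "\<phi> m x = max 0 (1 - real (Suc m) * max 0 (x\<^sup>2 - a\<^sup>2))" for m x
  \<comment> \<open>Since R^2 \<ge> a^2 + 1, this one bound contains the supports of all the
    ramps.\<close>
  define R where "R = a + 1"
  have R2: "a\<^sup>2 + 1 \<le> R\<^sup>2" using a by (simp add: R_def power2_eq_square algebra_simps)
  have supp: "\<phi> m x = 0" if "R < x" for m x
  proof -
    have "R\<^sup>2 \<le> x\<^sup>2" using that a by (intro power_mono) (auto simp: R_def)
    then have "1 \<le> x\<^sup>2 - a\<^sup>2" using R2 by simp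
    then have "1 * 1 \<le> real (Suc m) * max 0 (x\<^sup>2 - a\<^sup>2)" by (intro mult_mono) auto
    then show ?thesis by (simp add: \<phi>_def)
  qed
  have one: "\<phi> m x = 1" if "0 < x" "x \<le> a" for m x
    using that by (simp add: \<phi>_def power_mono)
  have range: "0 \<le> \<phi> m x" "\<phi> m x \<le> 1" for m x by (auto simp: \<phi>_def)
  have m[measurable]: "\<phi> m \<in> borel_measurable (bessel_measure \<alpha>)" for m
    unfolding \<phi>_def by measurable
  have K[measurable]: "{0<..r} \<in> sets (bessel_measure \<alpha>)" for r
    by (auto simp: sets_bessel_measure sets_restrict_space_iff)
  show ?thesis
  proof (rule energy_vanishes_dominated[where u = \<phi> and g = "indicator {0<..R}"])
    show "energy_vanishes (\<phi> m)" for m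
    proof (rule bessel_energy_vanishes_Lipschitz[OF \<alpha> m _ supp])
      fix x y :: real
      have "\<bar>\<phi> m x - \<phi> m y\<bar> \<le> \<bar>real (Suc m) * max 0 (x\<^sup>2 - a\<^sup>2) - real (Suc m) * max 0 (y\<^sup>2 - a\<^sup>2)\<bar>"
        unfolding \<phi>_def by linarith
      also have "\<dots> = real (Suc m) * \<bar>max 0 (x\<^sup>2 - a\<^sup>2) - max 0 (y\<^sup>2 - a\<^sup>2)\<bar>"
        by (simp only: right_diff_distrib[symmetric] abs_mult abs_of_nat)
      also have "\<dots> \<le> real (Suc m) * \<bar>y\<^sup>2 - x\<^sup>2\<bar>"
        by (intro mult_left_mono) linarith+
      finally show "\<bar>\<phi> m x - \<phi> m y\<bar> \<le> real (Suc m) * \<bar>y\<^sup>2 - x\<^sup>2\<bar>" .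
    qed
    fix x assume "x \<in> space (bessel_measure \<alpha>)"
    then have x: "0 < x" by simp
    show "(\<lambda>n. \<phi> n x) \<longlonglongrightarrow> indicator {0<..a} x"
    proof (cases "x \<le> a")
      case True
      then show ?thesis using one x by simp
    next
      case False
      then have pos: "0 < x\<^sup>2 - a\<^sup>2" using a x by (simp add: power_strict_mono)
      \<comment> \<open>Once slope times the gap x^2 - a^2 exceeds 1, the ramp is 0 at x.\<close>
      obtain N where N: "1 < real N * (x\<^sup>2 - a\<^sup>2)" using reals_Archimedean3[OF pos] by auto
      have "\<phi> n x = 0" if "N \<le> n" for n
      proof -
        have "real N * (x\<^sup>2 - a\<^sup>2) \<le> real (Suc n) * (x\<^sup>2 - a\<^sup>2)"
          using that pos by (intro mult_right_mono) auto
        then have "1 \<le> real (Suc n) * (x\<^sup>2 - a\<^sup>2)" using N by linarith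
        moreover have "max 0 (x\<^sup>2 - a\<^sup>2) = x\<^sup>2 - a\<^sup>2" using pos by simp
        ultimately show ?thesis unfolding \<phi>_def by (simp only: max_absorb1 diff_le_0_iff_le)
      qed
      then have "\<forall>\<^sub>F n in sequentially. \<phi> n x = 0" by (auto simp: eventually_sequentially)
      then show ?thesis using False by (simp add: tendsto_eventually)
    qed
    show "\<bar>indicator {0<..a} x - \<phi> n x\<bar> \<le> indicator {0<..R} x" for n
      using x one[of x n] range[of n x] supp[of x n] by (auto simp: R_def split: split_indicator)
  next
    have "(\<integral>\<^sup>+x. ennreal ((indicator {0<..R} x :: real)\<^sup>2) \<partial>bessel_measure \<alpha>)
        = (\<integral>\<^sup>+x. indicator {0<..R} x \<partial>bessel_measure \<alpha>)"
      by (intro nn_integral_cong) (simp split: split_indicator)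
    then show "(\<integral>\<^sup>+x. ennreal ((indicator {0<..R} x :: real)\<^sup>2) \<partial>bessel_measure \<alpha>) < \<infinity>"
      using emeasure_bessel_interval_finite[OF \<alpha>] by simp
  qed measurable
qed

text \<open>Half-lines bounded above generate the Borel sets and are stable under intersection;
  their traces on (0, n + 1] are empty or intervals (0, r]. The Dynkin argument thus settles the
  truncations of A, and the finite measure of A makes its indicator a dominating function as n
  grows.\<close>

lemma bessel_energy_vanishes_indicator:
  assumes \<alpha>: "-1 < \<alpha>" and A: "A \<in> sets (bessel_measure \<alpha>)" "emeasure (bessel_measure \<alpha>) A < \<infinity>"
  shows "symmetric_markov_kernel_semigroup.energy_vanishes (bessel_measure \<alpha>) (bessel_kernel \<alpha>) (indicator A)"
proof -
  interpret symmetric_markov_kernel_semigroup "bessel_measure \<alpha>" "bessel_kernel \<alpha>"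
    by (rule symmetric_markov_kernel_semigroup_bessel[OF \<alpha>])
  note [measurable] = A(1)
  let ?B = "\<lambda>n. {0<..real (Suc n)}"
  have K[measurable]: "{0<..r} \<in> sets (bessel_measure \<alpha>)" for r
    by (auto simp: sets_bessel_measure sets_restrict_space_iff)
  have borel: "A \<in> sigma_sets UNIV (range (\<lambda>a::real. {..a}))"
  proof -
    have "A \<in> sets borel"
      using A(1) by (auto simp: sets_bessel_measure sets_restrict_space_iff)
    then show ?thesis by (simp add: borel_eq_atMost)
  qed
  have trunc: "energy_vanishes (indicator (A \<inter> ?B n))" for n
  proof (rule energy_vanishes_Dynkin[OF _ _ _ _ _ _ _ _ borel])
    show "Int_stable (range (\<lambda>a::real. {..a}))"
      by (auto simp: Int_stable_def)
    show "emeasure (bessel_measure \<alpha>) (?B n) < \<infinity>" by (rule emeasure_bessel_interval_finite[OF \<alpha>])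
    show "S \<inter> ?B n \<in> sets (bessel_measure \<alpha>)" if "S \<in> sigma_sets UNIV (range (\<lambda>a::real. {..a}))" for S
    proof -
      have "S \<in> sets borel" using that by (simp add: borel_eq_atMost)
      then show ?thesis by (auto simp: sets_bessel_measure sets_restrict_space_iff)
    qed
    show "energy_vanishes (indicator (?B n))" by (rule bessel_energy_vanishes_interval[OF \<alpha>]) simp
    show "energy_vanishes (indicator (S \<inter> ?B n))" if S_range: "S \<in> range (\<lambda>a::real. {..a})" for S
    proof -
      obtain a where S: "S = {..a}" using S_range by auto
      show ?thesis
      proof (cases "0 < a")
        case True
        have "S \<inter> ?B n = {0<..min a (real (Suc n))}" unfolding S by auto
        then show ?thesis using True by (simp only:) (intro bessel_energy_vanishes_interval[OF \<alpha>], simp)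
      next
        case False
        then have "S \<inter> ?B n = {}" unfolding S by auto
        moreover have "indicator {} = (\<lambda>_::real. 0 :: real)" by (simp add: fun_eq_iff)
        ultimately show ?thesis using energy_vanishes_zero by (simp only:)
      qed
    qed
  qed (auto intro: K)
  show ?thesis
  proof (rule energy_vanishes_dominated[where g = "indicator A", OF _ _ _ trunc])
    fix x assume "x \<in> space (bessel_measure \<alpha>)"
    then have x: "0 < x" by simp
    obtain N where N: "x \<le> real N" using real_arch_simple by blast
    have "indicator (A \<inter> ?B n) x = (indicator A x :: real)" if "N \<le> n" for n
      using x N that by (auto split: split_indicator)
    then have "\<forall>\<^sub>F n in sequentially. indicator (A \<inter> ?B n) x = (indicator A x :: real)"
      by (auto simp: eventually_sequentially)
    then show "(\<lambda>n. indicator (A \<inter> ?B n) x :: real) \<longlonglongrightarrow> indicator A x" by (rule tendsto_eventually)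
    show "\<bar>indicator A x - indicator (A \<inter> ?B n) x\<bar> \<le> (indicator A x :: real)" for n
      by (simp split: split_indicator)
  next
    have "(\<integral>\<^sup>+x. ennreal ((indicator A x :: real)\<^sup>2) \<partial>bessel_measure \<alpha>)
        = (\<integral>\<^sup>+x. indicator A x \<partial>bessel_measure \<alpha>)"
      by (intro nn_integral_cong) (simp split: split_indicator)
    then show "(\<integral>\<^sup>+x. ennreal ((indicator A x :: real)\<^sup>2) \<partial>bessel_measure \<alpha>) < \<infinity>"
      using A by simp
  qed measurable
qed

theorem proposition6p2:
  fixes \<alpha> :: real
  assumes "\<alpha> > -1"
  shows "markovian_symmetric_diffusion_semigroup
           (bessel_measure \<alpha>) (L1_plus_Linf (bessel_measure \<alpha>)) (bessel_semigroup \<alpha>)"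
proof -
  interpret symmetric_markov_kernel_semigroup "bessel_measure \<alpha>" "bessel_kernel \<alpha>"
    by (rule symmetric_markov_kernel_semigroup_bessel[OF assms])
  have "bessel_semigroup \<alpha> = semigroup_op"
    by (simp add: fun_eq_iff bessel_semigroup_def semigroup_op_def)
  then show ?thesis
    using markovian[OF bessel_energy_vanishes_indicator[OF assms]] by simp
qed

end
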